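(* Let $K$ be a commutative ring, $A,B$ two $K$-algebras and $M,N$ two $A\otimes B^o$-modules. There exist two Lie subalgebras $\mathcal H^1(M,N)$ and $\mathcal H^1(N,M)$ of $HH^1\begin{pmatrix}A&M\oplus N\\0&B\end{pmatrix}$ such that $$\mathcal H^1(M,N)+\mathcal H^1(N,M)=HH^1\begin{pmatrix}A&M\oplus N\\0&B\end{pmatrix}\quad\text{and}\quad\mathcal H^1(M,N)\cap\mathcal H^1(N,M)=\mathcal H^1\{M,N\},$$ and such that $r^1_{M,N}$ induces by restriction morphisms of Lie algebras $$\rho^1_{M,(M,N)}:\mathcal H^1(M,N)\to HH^1\begin{pmatrix}A&M\\0&B\end{pmatrix},\quad \rho^1_{M,(N,M)}:\mathcal H^1(N,M)\to HH^1\begin{pmatrix}A&M\\0&B\end{pmatrix},\quad \rho^1_{M,\{M,N\}}:\mathcal H^1\{M,N\}\to HH^1\begin{pmatrix}A&M\\0&B\end{pmatrix},$$ each having the same image as $r^1_{M,N}$.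
   Context: $K$ is a commutative ring, $\otimes=\otimes_K$; algebras are associative unital $K$-algebras, modules are unital left modules, $B^o$ is the opposite algebra. No projectivity over $K$ is assumed. For an $A\otimes B^o$-module $M$, $\begin{pmatrix}A&M\\0&B\end{pmatrix}$ is the triangular matrix algebra with product $\begin{pmatrix}a&m\\0&b\end{pmatrix}\begin{pmatrix}a'&m'\\0&b'\end{pmatrix}=\begin{pmatrix}aa'&am'+mb'\\0&bb'\end{pmatrix}$. For an algebra $T$, $\mathrm{Der}(T)$ is the Lie algebra of $K$-linear derivations of $T$, $\mathrm{Int}(T)$ the Lie ideal of inner derivations $t\mapsto t_0t-tt_0$, and $HH^1T=\mathrm{Der}(T)/\mathrm{Int}(T)$ as a Lie algebra. Every derivation of $\begin{pmatrix}A&M\\0&B\end{pmatrix}$ has the form $\begin{pmatrix}a&m\\0&b\end{pmatrix}\mapsto\begin{pmatrix}\alpha(a)&\mu(m)-am_0+m_0b\\0&\beta(b)\end{pmatrix}$ with $\alpha\in\mathrm{Der}(A)$, $\beta\in\mathrm{Der}(B)$, $m_0\in M$, $\mu\in\mathrm{End}_K(M)$ satisfying $\mu(am)=\alpha(a)m+a\mu(m)$ and $\mu(mb)=\mu(m)b+m\beta(b)$. The derivations with $\alpha=0,\beta=0,\mu=0$ are inner, so every class in $HH^1$ is represented by a derivation with $m_0=0$, written $\begin{bmatrix}\alpha&\mu\\0&\beta\end{bmatrix}$. Let $M,N$ be $A\otimes B^o$-modules. If $\begin{bmatrix}\alpha&\gamma\\0&\beta\end{bmatrix}$ is such a derivation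 of $\begin{pmatrix}A&M\oplus N\\0&B\end{pmatrix}$, with $\gamma\in\mathrm{End}_K(M\oplus N)$, and $\mu\in \mathrm{End}_K(M)$ is the component $M\to M$ of $\gamma$, then $\begin{bmatrix}\alpha&\mu\\0&\beta\end{bmatrix}$ is a derivation of $\begin{pmatrix}A&M\\0&B\end{pmatrix}$; the assignment $\begin{bmatrix}\alpha&\gamma\\0&\beta\end{bmatrix}\mapsto\begin{bmatrix}\alpha&\mu\\0&\beta\end{bmatrix}$ induces a $K$-linear map $r^1_{M,N}:HH^1\begin{pmatrix}A&M\oplus N\\0&B\end{pmatrix}\to HH^1\begin{pmatrix}A&M\\0&B\end{pmatrix}$ (not a priori a Lie morphism). $\mathcal H^1\{M,N\}\subset HH^1\begin{pmatrix}A&M\oplus N\\0&B\end{pmatrix}$ is the Lie subalgebra of classes of derivations $\begin{bmatrix}\alpha&\gamma\\0&\beta\end{bmatrix}$ whose $\gamma$ has zero components $M\to N$ and $N\to M$. *)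

theory Defs
  imports "HOL-Algebra.Module" "HOL-Algebra.QuotRing"
begin

text \<open>
  All structures are records with explicit carriers, so that zero rings and zero modules are allowed.
  Maps between carriers are extensional (\<open>undefined\<close> outside the carrier), so that two maps are
  equal iff they agree on the carrier.
\<close>


section \<open>Algebras and bimodules over a commutative ring\<close>

text \<open>The locale \<^locale>\<open>algebra\<close> of HOL-Algebra is about commutative algebras only.\<close>

locale unital_algebra = module K A + A: ring A
  for K :: "'k ring" and A :: "('k, 'a) module" +
  assumes smult_mult_left:
      "\<lbrakk>k \<in> carrier K; x \<in> carrier A; y \<in> carrier A\<rbrakk>
        \<Longrightarrow> (k \<odot>\<^bsub>A\<^esub> x) \<otimes>\<^bsub>A\<^esub> y = k \<odot>\<^bsub>A\<^esub> (x \<otimes>\<^bsub>A\<^esub> y)"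
    and smult_mult_right:
      "\<lbrakk>k \<in> carrier K; x \<in> carrier A; y \<in> carrier A\<rbrakk>
        \<Longrightarrow> x \<otimes>\<^bsub>A\<^esub> (k \<odot>\<^bsub>A\<^esub> y) = k \<odot>\<^bsub>A\<^esub> (x \<otimes>\<^bsub>A\<^esub> y)"

record ('k, 'a, 'b, 'm) bimod = "('k, 'm) module" +
  lact :: "'a \<Rightarrow> 'm \<Rightarrow> 'm"
  ract :: "'m \<Rightarrow> 'b \<Rightarrow> 'm"

text \<open>
  A left module over \<open>A \<otimes>\<^sub>K B\<^sup>o\<close>, with \<open>(a \<otimes> b) m\<close> written \<open>a m b\<close>: commuting unital actions of
  \<open>A\<close> on the left and of \<open>B\<close> on the right that induce the same action of \<open>K\<close>.
  The fields \<open>mult\<close> and \<open>one\<close>, inherited from \<open>module\<close>, play no role.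
\<close>

locale bimodule = A: unital_algebra K A + B: unital_algebra K B + M: module K M
  for K :: "'k ring" and A :: "('k, 'a) module" and B :: "('k, 'b) module"
    and M :: "('k, 'a, 'b, 'm) bimod" +
  assumes lact_closed:
      "\<lbrakk>a \<in> carrier A; m \<in> carrier M\<rbrakk> \<Longrightarrow> lact M a m \<in> carrier M"
    and lact_add_left:
      "\<lbrakk>a \<in> carrier A; a' \<in> carrier A; m \<in> carrier M\<rbrakk>
        \<Longrightarrow> lact M (a \<oplus>\<^bsub>A\<^esub> a') m = lact M a m \<oplus>\<^bsub>M\<^esub> lact M a' m"
    and lact_add_right:
      "\<lbrakk>a \<in> carrier A; m \<in> carrier M; m' \<in> carrier M\<rbrakk>
        \<Longrightarrow> lact M a (m \<oplus>\<^bsub>M\<^esub> m') = lact M a m \<oplus>\<^bsub>M\<^esub> lact M a m'"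
    and lact_mult:
      "\<lbrakk>a \<in> carrier A; a' \<in> carrier A; m \<in> carrier M\<rbrakk>
        \<Longrightarrow> lact M (a \<otimes>\<^bsub>A\<^esub> a') m = lact M a (lact M a' m)"
    and lact_one:
      "m \<in> carrier M \<Longrightarrow> lact M \<one>\<^bsub>A\<^esub> m = m"
    and ract_closed:
      "\<lbrakk>m \<in> carrier M; b \<in> carrier B\<rbrakk> \<Longrightarrow> ract M m b \<in> carrier M"
    and ract_add_left:
      "\<lbrakk>m \<in> carrier M; m' \<in> carrier M; b \<in> carrier B\<rbrakk>
        \<Longrightarrow> ract M (m \<oplus>\<^bsub>M\<^esub> m') b = ract M m b \<oplus>\<^bsub>M\<^esub> ract M m' b"
    and ract_add_right:
      "\<lbrakk>m \<in> carrier M; b \<in> carrier B; b' \<in> carrier B\<rbrakk>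
        \<Longrightarrow> ract M m (b \<oplus>\<^bsub>B\<^esub> b') = ract M m b \<oplus>\<^bsub>M\<^esub> ract M m b'"
    and ract_mult:
      "\<lbrakk>m \<in> carrier M; b \<in> carrier B; b' \<in> carrier B\<rbrakk>
        \<Longrightarrow> ract M m (b \<otimes>\<^bsub>B\<^esub> b') = ract M (ract M m b) b'"
    and ract_one:
      "m \<in> carrier M \<Longrightarrow> ract M m \<one>\<^bsub>B\<^esub> = m"
    and lact_ract:
      "\<lbrakk>a \<in> carrier A; m \<in> carrier M; b \<in> carrier B\<rbrakk>
        \<Longrightarrow> lact M a (ract M m b) = ract M (lact M a m) b"
    and lact_smult_left:
      "\<lbrakk>k \<in> carrier K; a \<in> carrier A; m \<in> carrier M\<rbrakk>
        \<Longrightarrow> lact M (k \<odot>\<^bsub>A\<^esub> a) m = k \<odot>\<^bsub>M\<^esub> lact M a m"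
    and lact_smult_right:
      "\<lbrakk>k \<in> carrier K; a \<in> carrier A; m \<in> carrier M\<rbrakk>
        \<Longrightarrow> lact M a (k \<odot>\<^bsub>M\<^esub> m) = k \<odot>\<^bsub>M\<^esub> lact M a m"
    and ract_smult_left:
      "\<lbrakk>k \<in> carrier K; m \<in> carrier M; b \<in> carrier B\<rbrakk>
        \<Longrightarrow> ract M (k \<odot>\<^bsub>M\<^esub> m) b = k \<odot>\<^bsub>M\<^esub> ract M m b"
    and ract_smult_right:
      "\<lbrakk>k \<in> carrier K; m \<in> carrier M; b \<in> carrier B\<rbrakk>
        \<Longrightarrow> ract M m (k \<odot>\<^bsub>B\<^esub> b) = k \<odot>\<^bsub>M\<^esub> ract M m b"

definition bimod_sum ::
  "('k, 'a, 'b, 'm) bimod \<Rightarrow> ('k, 'a, 'b, 'n) bimod \<Rightarrow> ('k, 'a, 'b, 'm \<times> 'n) bimod"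
  where "bimod_sum M N =
    \<lparr>carrier = carrier M \<times> carrier N,
     mult = undefined, one = undefined,
     zero = (\<zero>\<^bsub>M\<^esub>, \<zero>\<^bsub>N\<^esub>),
     add = (\<lambda>(m, n) (m', n'). (m \<oplus>\<^bsub>M\<^esub> m', n \<oplus>\<^bsub>N\<^esub> n')),
     smult = (\<lambda>k (m, n). (k \<odot>\<^bsub>M\<^esub> m, k \<odot>\<^bsub>N\<^esub> n)),
     lact = (\<lambda>a (m, n). (lact M a m, lact N a n)),
     ract = (\<lambda>(m, n) b. (ract M m b, ract N n b))\<rparr>"

text \<open>The triple \<open>(a, m, b)\<close> stands for the matrix with rows \<open>(a, m)\<close> and \<open>(0, b)\<close>.\<close>

definition tri_algebra ::
  "('k, 'a) module \<Rightarrow> ('k, 'a, 'b, 'm) bimod \<Rightarrow> ('k, 'b) module \<Rightarrow> ('k, 'a \<times> 'm \<times> 'b) module"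
  where "tri_algebra A M B =
    \<lparr>carrier = carrier A \<times> carrier M \<times> carrier B,
     mult = (\<lambda>(a, m, b) (a', m', b').
       (a \<otimes>\<^bsub>A\<^esub> a', lact M a m' \<oplus>\<^bsub>M\<^esub> ract M m b', b \<otimes>\<^bsub>B\<^esub> b')),
     one = (\<one>\<^bsub>A\<^esub>, \<zero>\<^bsub>M\<^esub>, \<one>\<^bsub>B\<^esub>),
     zero = (\<zero>\<^bsub>A\<^esub>, \<zero>\<^bsub>M\<^esub>, \<zero>\<^bsub>B\<^esub>),
     add = (\<lambda>(a, m, b) (a', m', b'). (a \<oplus>\<^bsub>A\<^esub> a', m \<oplus>\<^bsub>M\<^esub> m', b \<oplus>\<^bsub>B\<^esub> b')),
     smult = (\<lambda>k (a, m, b). (k \<odot>\<^bsub>A\<^esub> a, k \<odot>\<^bsub>M\<^esub> m, k \<odot>\<^bsub>B\<^esub> b))\<rparr>"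


section \<open>Lie algebras\<close>

text \<open>The fields \<open>mult\<close> and \<open>one\<close>, inherited from \<open>module\<close>, play no role in a Lie algebra.\<close>

record ('k, 'l) lie = "('k, 'l) module" +
  bracket :: "'l \<Rightarrow> 'l \<Rightarrow> 'l"

locale lie_algebra = module K L
  for K :: "'k ring" and L :: "('k, 'l) lie" +
  assumes bracket_closed:
      "\<lbrakk>x \<in> carrier L; y \<in> carrier L\<rbrakk> \<Longrightarrow> bracket L x y \<in> carrier L"
    and bracket_add_left:
      "\<lbrakk>x \<in> carrier L; y \<in> carrier L; z \<in> carrier L\<rbrakk>
        \<Longrightarrow> bracket L (x \<oplus>\<^bsub>L\<^esub> y) z = bracket L x z \<oplus>\<^bsub>L\<^esub> bracket L y z"
    and bracket_add_right:
      "\<lbrakk>x \<in> carrier L; y \<in> carrier L; z \<in> carrier L\<rbrakk>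
        \<Longrightarrow> bracket L x (y \<oplus>\<^bsub>L\<^esub> z) = bracket L x y \<oplus>\<^bsub>L\<^esub> bracket L x z"
    and bracket_smult_left:
      "\<lbrakk>k \<in> carrier K; x \<in> carrier L; y \<in> carrier L\<rbrakk>
        \<Longrightarrow> bracket L (k \<odot>\<^bsub>L\<^esub> x) y = k \<odot>\<^bsub>L\<^esub> bracket L x y"
    and bracket_smult_right:
      "\<lbrakk>k \<in> carrier K; x \<in> carrier L; y \<in> carrier L\<rbrakk>
        \<Longrightarrow> bracket L x (k \<odot>\<^bsub>L\<^esub> y) = k \<odot>\<^bsub>L\<^esub> bracket L x y"
    and bracket_self:
      "x \<in> carrier L \<Longrightarrow> bracket L x x = \<zero>\<^bsub>L\<^esub>"
    and jacobi:
      "\<lbrakk>x \<in> carrier L; y \<in> carrier L; z \<in> carrier L\<rbrakk>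
        \<Longrightarrow> bracket L x (bracket L y z) \<oplus>\<^bsub>L\<^esub> bracket L y (bracket L z x)
             \<oplus>\<^bsub>L\<^esub> bracket L z (bracket L x y) = \<zero>\<^bsub>L\<^esub>"

locale lie_subalgebra = lie_algebra K L + submodule H K L
  for H :: "'l set" and K :: "'k ring" and L :: "('k, 'l) lie" +
  assumes bracket_mem: "\<lbrakk>x \<in> H; y \<in> H\<rbrakk> \<Longrightarrow> bracket L x y \<in> H"

definition lie_hom :: "'k ring \<Rightarrow> ('k, 'l) lie \<Rightarrow> ('k, 'h) lie \<Rightarrow> ('l \<Rightarrow> 'h) set"
  where "lie_hom K L L' =
    {f \<in> carrier L \<rightarrow> carrier L'.
      (\<forall>x\<in>carrier L. \<forall>y\<in>carrier L. f (x \<oplus>\<^bsub>L\<^esub> y) = f x \<oplus>\<^bsub>L'\<^esub> f y) \<and>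
      (\<forall>k\<in>carrier K. \<forall>x\<in>carrier L. f (k \<odot>\<^bsub>L\<^esub> x) = k \<odot>\<^bsub>L'\<^esub> f x) \<and>
      (\<forall>x\<in>carrier L. \<forall>y\<in>carrier L. f (bracket L x y) = bracket L' (f x) (f y))}"

text \<open>The quotient by a Lie ideal \<open>I\<close>, following \<^const>\<open>FactRing\<close> and \<^const>\<open>rcoset_mult\<close>.\<close>

definition lie_quotient :: "('k, 'l) lie \<Rightarrow> 'l set \<Rightarrow> ('k, 'l set) lie"
  where "lie_quotient L I =
    \<lparr>carrier = a_rcosets\<^bsub>L\<^esub> I,
     mult = undefined, one = undefined,
     zero = I,
     add = set_add L,
     smult = (\<lambda>k X. \<Union>x\<in>X. I +>\<^bsub>L\<^esub> (k \<odot>\<^bsub>L\<^esub> x)),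
     bracket = (\<lambda>X Y. \<Union>x\<in>X. \<Union>y\<in>Y. I +>\<^bsub>L\<^esub> bracket L x y)\<rparr>"


section \<open>Derivations and the first Hochschild cohomology\<close>

definition lin_End :: "'k ring \<Rightarrow> ('k, 'm, 'x) module_scheme \<Rightarrow> ('m \<Rightarrow> 'm) set"
  where "lin_End K M =
    {f \<in> carrier M \<rightarrow>\<^sub>E carrier M.
      (\<forall>x\<in>carrier M. \<forall>y\<in>carrier M. f (x \<oplus>\<^bsub>M\<^esub> y) = f x \<oplus>\<^bsub>M\<^esub> f y) \<and>
      (\<forall>k\<in>carrier K. \<forall>x\<in>carrier M. f (k \<odot>\<^bsub>M\<^esub> x) = k \<odot>\<^bsub>M\<^esub> f x)}"

definition derivations :: "'k ring \<Rightarrow> ('k, 't) module \<Rightarrow> ('t \<Rightarrow> 't) set"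
  where "derivations K T =
    {d \<in> lin_End K T. \<forall>x\<in>carrier T. \<forall>y\<in>carrier T.
      d (x \<otimes>\<^bsub>T\<^esub> y) = d x \<otimes>\<^bsub>T\<^esub> y \<oplus>\<^bsub>T\<^esub> x \<otimes>\<^bsub>T\<^esub> d y}"

definition Der :: "'k ring \<Rightarrow> ('k, 't) module \<Rightarrow> ('k, 't \<Rightarrow> 't) lie"
  where "Der K T =
    \<lparr>carrier = derivations K T,
     mult = undefined, one = undefined,
     zero = (\<lambda>t\<in>carrier T. \<zero>\<^bsub>T\<^esub>),
     add = (\<lambda>d e. \<lambda>t\<in>carrier T. d t \<oplus>\<^bsub>T\<^esub> e t),
     smult = (\<lambda>k d. \<lambda>t\<in>carrier T. k \<odot>\<^bsub>T\<^esub> d t),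
     bracket = (\<lambda>d e. \<lambda>t\<in>carrier T. d (e t) \<ominus>\<^bsub>T\<^esub> e (d t))\<rparr>"

definition Int_der :: "('k, 't) module \<Rightarrow> ('t \<Rightarrow> 't) set"
  where "Int_der T =
    (\<lambda>t\<^sub>0. \<lambda>t\<in>carrier T. t\<^sub>0 \<otimes>\<^bsub>T\<^esub> t \<ominus>\<^bsub>T\<^esub> t \<otimes>\<^bsub>T\<^esub> t\<^sub>0) ` carrier T"

definition HH1 :: "'k ring \<Rightarrow> ('k, 't) module \<Rightarrow> ('k, ('t \<Rightarrow> 't) set) lie"
  where "HH1 K T = lie_quotient (Der K T) (Int_der T)"

definition HH1_class :: "'k ring \<Rightarrow> ('k, 't) module \<Rightarrow> ('t \<Rightarrow> 't) \<Rightarrow> ('t \<Rightarrow> 't) set"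
  where "HH1_class K T d = Int_der T +>\<^bsub>Der K T\<^esub> d"


section \<open>Derivations of triangular matrix algebras\<close>

text \<open>
  \<open>tri_data K A M B\<close> is the set of triples \<open>(\<alpha>, \<mu>, \<beta>)\<close> for which the map \<open>tri_der A M B \<alpha> \<mu> \<beta>\<close>,
  that is \<open>(a, m, b) \<mapsto> (\<alpha> a, \<mu> m, \<beta> b)\<close>, is a derivation of \<open>tri_algebra A M B\<close>: these are the
  derivations with \<open>m\<^sub>0 = 0\<close>, written as the matrix with rows \<open>[\<alpha> \<mu>]\<close> and \<open>[0 \<beta>]\<close>.
\<close>

definition tri_data ::
  "'k ring \<Rightarrow> ('k, 'a) module \<Rightarrow> ('k, 'a, 'b, 'm) bimod \<Rightarrow> ('k, 'b) module
    \<Rightarrow> (('a \<Rightarrow> 'a) \<times> ('m \<Rightarrow> 'm) \<times> ('b \<Rightarrow> 'b)) set"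
  where "tri_data K A M B =
    {(\<alpha>, \<mu>, \<beta>). \<alpha> \<in> derivations K A \<and> \<beta> \<in> derivations K B \<and> \<mu> \<in> lin_End K M \<and>
      (\<forall>a\<in>carrier A. \<forall>m\<in>carrier M.
        \<mu> (lact M a m) = lact M (\<alpha> a) m \<oplus>\<^bsub>M\<^esub> lact M a (\<mu> m)) \<and>
      (\<forall>m\<in>carrier M. \<forall>b\<in>carrier B.
        \<mu> (ract M m b) = ract M (\<mu> m) b \<oplus>\<^bsub>M\<^esub> ract M m (\<beta> b))}"

definition tri_der ::
  "('k, 'a) module \<Rightarrow> ('k, 'a, 'b, 'm) bimod \<Rightarrow> ('k, 'b) module
    \<Rightarrow> ('a \<Rightarrow> 'a) \<Rightarrow> ('m \<Rightarrow> 'm) \<Rightarrow> ('b \<Rightarrow> 'b) \<Rightarrow> 'a \<times> 'm \<times> 'b \<Rightarrow> 'a \<times> 'm \<times> 'b"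
  where "tri_der A M B \<alpha> \<mu> \<beta> =
    (\<lambda>(a, m, b)\<in>carrier (tri_algebra A M B). (\<alpha> a, \<mu> m, \<beta> b))"

definition comp_MM ::
  "('k, 'a, 'b, 'm) bimod \<Rightarrow> ('k, 'a, 'b, 'n) bimod \<Rightarrow> ('m \<times> 'n \<Rightarrow> 'm \<times> 'n) \<Rightarrow> 'm \<Rightarrow> 'm"
  where "comp_MM M N \<gamma> = (\<lambda>m\<in>carrier M. fst (\<gamma> (m, \<zero>\<^bsub>N\<^esub>)))"

definition comp_MN ::
  "('k, 'a, 'b, 'm) bimod \<Rightarrow> ('k, 'a, 'b, 'n) bimod \<Rightarrow> ('m \<times> 'n \<Rightarrow> 'm \<times> 'n) \<Rightarrow> 'm \<Rightarrow> 'n"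
  where "comp_MN M N \<gamma> = (\<lambda>m\<in>carrier M. snd (\<gamma> (m, \<zero>\<^bsub>N\<^esub>)))"

definition comp_NM ::
  "('k, 'a, 'b, 'm) bimod \<Rightarrow> ('k, 'a, 'b, 'n) bimod \<Rightarrow> ('m \<times> 'n \<Rightarrow> 'm \<times> 'n) \<Rightarrow> 'n \<Rightarrow> 'm"
  where "comp_NM M N \<gamma> = (\<lambda>n\<in>carrier N. fst (\<gamma> (\<zero>\<^bsub>M\<^esub>, n)))"

text \<open>
  The map \<open>r\<^sup>1\<^bsub>M,N\<^esub>\<close>. The union runs over all representatives with \<open>m\<^sub>0 = 0\<close> of the class \<open>X\<close>. These
  exist, and the class of the restriction does not depend on the choice, so it is a union of copies
  of a single coset.
\<close>

definition r1 ::
  "'k ring \<Rightarrow> ('k, 'a) module \<Rightarrow> ('k, 'b) module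
    \<Rightarrow> ('k, 'a, 'b, 'm) bimod \<Rightarrow> ('k, 'a, 'b, 'n) bimod
    \<Rightarrow> ('a \<times> ('m \<times> 'n) \<times> 'b \<Rightarrow> 'a \<times> ('m \<times> 'n) \<times> 'b) set
    \<Rightarrow> ('a \<times> 'm \<times> 'b \<Rightarrow> 'a \<times> 'm \<times> 'b) set"
  where "r1 K A B M N X =
    \<Union>{HH1_class K (tri_algebra A M B) (tri_der A M B \<alpha> (comp_MM M N \<gamma>) \<beta>) | \<alpha> \<gamma> \<beta>.
        (\<alpha>, \<gamma>, \<beta>) \<in> tri_data K A (bimod_sum M N) B \<and>
        tri_der A (bimod_sum M N) B \<alpha> \<gamma> \<beta> \<in> X}"

text \<open>The Lie subalgebra \<open>\<H>\<^sup>1{M, N}\<close>.\<close>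

definition H1_diag ::
  "'k ring \<Rightarrow> ('k, 'a) module \<Rightarrow> ('k, 'b) module
    \<Rightarrow> ('k, 'a, 'b, 'm) bimod \<Rightarrow> ('k, 'a, 'b, 'n) bimod
    \<Rightarrow> ('a \<times> ('m \<times> 'n) \<times> 'b \<Rightarrow> 'a \<times> ('m \<times> 'n) \<times> 'b) set set"
  where "H1_diag K A B M N =
    {HH1_class K (tri_algebra A (bimod_sum M N) B) (tri_der A (bimod_sum M N) B \<alpha> \<gamma> \<beta>) | \<alpha> \<gamma> \<beta>.
        (\<alpha>, \<gamma>, \<beta>) \<in> tri_data K A (bimod_sum M N) B \<and>
        comp_MN M N \<gamma> = (\<lambda>m\<in>carrier M. \<zero>\<^bsub>N\<^esub>) \<and>
        comp_NM M N \<gamma> = (\<lambda>n\<in>carrier N. \<zero>\<^bsub>M\<^esub>)}"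

end

theory Submission
  imports Defs
begin

text \<open>
  Write \<open>T\<close> and \<open>S\<close> for the triangular algebras with corner \<open>M \<oplus> N\<close> and \<open>M\<close>. Dropping the entry
  in \<open>N\<close> is an algebra map \<open>\<pi> : T \<rightarrow> S\<close>, filling it with zero is an algebra map \<open>\<iota> : S \<rightarrow> T\<close>, and
  \<open>\<pi> \<circ> \<iota> = id\<close>. The kernel \<open>J = N\<close> of \<open>\<pi>\<close> has square zero. Everything except the comparison with
  \<open>r\<^sup>1\<^bsub>M,N\<^esub>\<close> and \<open>\<H>\<^sup>1{M, N}\<close> is true for any such split extension with kernel of square zero.

  Put \<open>\<theta> = \<iota> \<circ> \<pi>\<close>. Relative to \<open>T = \<iota>(S) \<oplus> J\<close> a derivation \<open>d\<close> is a block matrix, with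
  off-diagonal blocks \<open>(1 - \<theta>) d \<theta> : \<iota>(S) \<rightarrow> J\<close> and \<open>\<theta> d (1 - \<theta>) : J \<rightarrow> \<iota>(S)\<close>. Because \<open>J\<^sup>2 = 0\<close>, each
  off-diagonal block is again a derivation (\<open>to_kernel_derivation\<close>, \<open>from_kernel_derivation\<close>). So the
  derivations \<open>D\<^sub>1\<close> that preserve \<open>J\<close> and the derivations \<open>D\<^sub>2\<close> that preserve \<open>\<iota>(S)\<close>, that is the two
  kinds of block triangular matrices, are Lie subalgebras with sum \<open>Der T\<close>. Their classes are
  \<open>\<H>\<^sup>1(M, N)\<close> and \<open>\<H>\<^sup>1(N, M)\<close>. Since \<open>J\<close> is an ideal, \<open>D\<^sub>1\<close> contains all inner derivations, and
  hence the classes common to \<open>D\<^sub>1\<close> and \<open>D\<^sub>2\<close> are those of \<open>D\<^sub>1 \<inter> D\<^sub>2\<close> (\<open>classes_inter\<close>).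

  The map \<open>d \<mapsto> \<pi> \<circ> d \<circ> \<iota>\<close> sends derivations of \<open>T\<close> to derivations of \<open>S\<close> and inner ones to inner
  ones. It takes the upper left block of the matrix, and this respects products of block triangular
  matrices: hence the three morphisms of Lie algebras. It depends only on the diagonal part of \<open>d\<close>,
  which lies in \<open>D\<^sub>1 \<inter> D\<^sub>2\<close>: hence the equality of the images (\<open>decomposition\<close>).

  The triangular shape enters only in that comparison, through \<open>derivation_normal_form\<close>: adding
  an inner derivation makes \<open>d\<close> vanish on the idempotent \<open>e\<^sub>1\<close>, and then \<open>d\<close> is of the form \<open>(a, m, b) \<mapsto> (\<alpha> a, \<mu> m, \<beta> b)\<close>.
  This yields that \<open>r\<^sup>1\<^bsub>M,N\<^esub>\<close> is induced by \<open>d \<mapsto> \<pi> \<circ> d \<circ> \<iota>\<close> (\<open>r1_class\<close>) and that \<open>\<H>\<^sup>1{M, N}\<close>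
  consists of the classes of \<open>D\<^sub>1 \<inter> D\<^sub>2\<close> (\<open>H1_diag_eq\<close>).
\<close>

section \<open>Images and quotients of Lie algebras\<close>

text \<open>
  A surjection onto a bare record that respects the operations carries all Lie algebra axioms over
  to the target. For a quotient, only the four compatibilities then need a computation with cosets.
\<close>

locale lie_epimorphism = L: lie_algebra K L
  for K :: "'k ring" and L :: "('k, 'l) lie" +
  fixes Q :: "('k, 'q) lie" and f :: "'l \<Rightarrow> 'q"
  assumes image_carrier: "f ` carrier L = carrier Q"
    and hom_zero: "\<zero>\<^bsub>Q\<^esub> = f \<zero>\<^bsub>L\<^esub>"
    and hom_add: "\<lbrakk>x \<in> carrier L; y \<in> carrier L\<rbrakk> \<Longrightarrow> f x \<oplus>\<^bsub>Q\<^esub> f y = f (x \<oplus>\<^bsub>L\<^esub> y)"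
    and hom_smult: "\<lbrakk>k \<in> carrier K; x \<in> carrier L\<rbrakk> \<Longrightarrow> k \<odot>\<^bsub>Q\<^esub> f x = f (k \<odot>\<^bsub>L\<^esub> x)"
    and hom_bracket: "\<lbrakk>x \<in> carrier L; y \<in> carrier L\<rbrakk> \<Longrightarrow> bracket Q (f x) (f y) = f (bracket L x y)"
begin

lemma hom_closed: "x \<in> carrier L \<Longrightarrow> f x \<in> carrier Q"
  using image_carrier by blast

lemma surj_elim:
  assumes "X \<in> carrier Q" obtains x where "x \<in> carrier L" "X = f x"
  using assms image_carrier by blast

lemmas hom_simps = hom_zero hom_add hom_smult hom_bracket

lemma abelian_group_target: "abelian_group Q"
proof (rule abelian_groupI)
  fix X assume "X \<in> carrier Q"
  then obtain x where "x \<in> carrier L" "X = f x" by (rule surj_elim)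
  then show "\<exists>Y\<in>carrier Q. Y \<oplus>\<^bsub>Q\<^esub> X = \<zero>\<^bsub>Q\<^esub>"
    by (intro bexI[of _ "f (\<ominus>\<^bsub>L\<^esub> x)"]) (auto simp: hom_simps hom_closed L.M.l_neg)
qed (auto elim!: surj_elim simp: hom_simps hom_closed L.M.a_assoc
    intro!: arg_cong[of _ _ f] L.M.a_comm)

lemma lie_algebra_target: "lie_algebra K Q"
proof -
  have "module K Q"
    by (rule moduleI[OF L.R.is_cring abelian_group_target])
      (auto elim!: surj_elim simp: hom_simps hom_closed L.smult_l_distr L.smult_r_distr L.smult_assoc1)
  moreover have "lie_algebra_axioms K Q"
    by unfold_locales
      (auto elim!: surj_elim simp: hom_simps hom_closed L.bracket_closed L.bracket_add_left
        L.bracket_add_right L.bracket_smult_left L.bracket_smult_right L.bracket_self L.jacobi)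
  ultimately show ?thesis by (rule lie_algebra.intro)
qed

lemma lie_subalgebra_image:
  assumes "lie_subalgebra H K L" shows "lie_subalgebra (f ` H) K Q"
proof -
  interpret H: lie_subalgebra H K L by fact
  interpret Q: lie_algebra K Q by (rule lie_algebra_target)
  note HL = H.subset[simplified]
  have inv: "\<ominus>\<^bsub>Q\<^esub> f x = f (\<ominus>\<^bsub>L\<^esub> x)" if "x \<in> carrier L" for x
    using that by (intro Q.M.minus_equality) (auto simp: hom_simps hom_closed L.M.l_neg)
  have sub: "x \<in> carrier L" if "x \<in> H" for x using HL that by auto
  note E = L.submoduleE[OF H.submodule_axioms]
  have "submodule (f ` H) K Q"
  proof (rule Q.submoduleI)
    show "f ` H \<subseteq> carrier Q" using HL hom_closed by auto
    show "\<zero>\<^bsub>Q\<^esub> \<in> f ` H" using H.one_closed by (auto simp: hom_zero)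
  next
    fix X assume "X \<in> f ` H"
    then show "\<ominus>\<^bsub>Q\<^esub> X \<in> f ` H" using inv sub E(3) by auto
  next
    fix X Y assume "X \<in> f ` H" "Y \<in> f ` H"
    then show "X \<oplus>\<^bsub>Q\<^esub> Y \<in> f ` H" using sub E(5) by (auto simp: hom_simps)
  next
    fix k X assume "k \<in> carrier K" "X \<in> f ` H"
    then show "k \<odot>\<^bsub>Q\<^esub> X \<in> f ` H" using sub E(4) by (auto simp: hom_simps)
  qed
  then show ?thesis
    using lie_algebra_target sub H.bracket_mem
    by (intro lie_subalgebra.intro lie_subalgebra_axioms.intro) (auto simp: hom_simps)
qed

end

lemma (in lie_algebra) anticommutative:
  assumes "x \<in> carrier L" "y \<in> carrier L"
  shows "bracket L y x = \<ominus>\<^bsub>L\<^esub> bracket L x y"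
proof -
  have "bracket L (x \<oplus>\<^bsub>L\<^esub> y) (x \<oplus>\<^bsub>L\<^esub> y) = \<zero>\<^bsub>L\<^esub>" using assms by (simp add: bracket_self)
  then have "bracket L y x \<oplus>\<^bsub>L\<^esub> bracket L x y = \<zero>\<^bsub>L\<^esub>"
    using assms by (simp add: bracket_add_left bracket_add_right bracket_self[OF assms(1)]
        bracket_self[OF assms(2)] bracket_closed)
  then show ?thesis using assms by (simp add: M.minus_equality bracket_closed)
qed

locale lie_ideal = lie_algebra K L + submodule I K L
  for I :: "'l set" and K :: "'k ring" and L :: "('k, 'l) lie" +
  assumes bracket_ideal: "\<lbrakk>x \<in> carrier L; y \<in> I\<rbrakk> \<Longrightarrow> bracket L x y \<in> I"
begin

sublocale I: abelian_subgroup I L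
  by (intro abelian_subgroupI3 additive_subgroup.intro subgroup_axioms M.abelian_group_axioms)

lemma bracket_ideal_left:
  assumes "x \<in> I" "y \<in> carrier L" shows "bracket L x y \<in> I"
proof -
  have "bracket L x y = \<ominus>\<^bsub>L\<^esub> bracket L y x"
    using assms by (intro anticommutative) auto
  then show ?thesis using assms bracket_ideal by auto
qed

lemma coset_eq_iff:
  assumes "x \<in> carrier L" "y \<in> carrier L"
  shows "I +>\<^bsub>L\<^esub> x = I +>\<^bsub>L\<^esub> y \<longleftrightarrow> x \<ominus>\<^bsub>L\<^esub> y \<in> I"
  using assms I.a_rcos_module[of y x] I.a_rcos_self[of x] I.a_repr_independence'[of x y]
  by (auto simp: M.minus_eq)

lemma mem_coset:
  assumes "x \<in> carrier L" "x' \<in> I +>\<^bsub>L\<^esub> x"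
  shows "x' \<in> carrier L" "x' \<ominus>\<^bsub>L\<^esub> x \<in> I"
proof -
  show 1: "x' \<in> carrier L" using I.a_elemrcos_carrier assms by blast
  show "x' \<ominus>\<^bsub>L\<^esub> x \<in> I" using I.a_rcos_module[of x x'] assms 1 by (auto simp: M.minus_eq)
qed

sublocale quotient: lie_epimorphism K L "lie_quotient L I" "\<lambda>x. I +>\<^bsub>L\<^esub> x"
proof unfold_locales
  show "(+>\<^bsub>L\<^esub>) I ` carrier L = carrier (lie_quotient L I)"
    by (auto simp: lie_quotient_def A_RCOSETS_def RCOSETS_def a_r_coset_def)
  show "\<zero>\<^bsub>lie_quotient L I\<^esub> = I +>\<^bsub>L\<^esub> \<zero>\<^bsub>L\<^esub>"
    using M.a_coset_add_zero[OF I.a_subset] by (simp add: lie_quotient_def)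
next
  fix x y assume xy: "x \<in> carrier L" "y \<in> carrier L"
  then show "(I +>\<^bsub>L\<^esub> x) \<oplus>\<^bsub>lie_quotient L I\<^esub> (I +>\<^bsub>L\<^esub> y) = I +>\<^bsub>L\<^esub> (x \<oplus>\<^bsub>L\<^esub> y)"
    by (simp add: lie_quotient_def I.a_rcos_sum)
  have "I +>\<^bsub>L\<^esub> bracket L x' y' = I +>\<^bsub>L\<^esub> bracket L x y"
    if "x' \<in> I +>\<^bsub>L\<^esub> x" "y' \<in> I +>\<^bsub>L\<^esub> y" for x' y'
  proof -
    note xy' = mem_coset[OF xy(1) that(1)] mem_coset[OF xy(2) that(2)]
    \<comment> \<open>Vary one argument of the bracket at a time.\<close>
    have "bracket L x' y' \<ominus>\<^bsub>L\<^esub> bracket L x y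
      = bracket L (x' \<ominus>\<^bsub>L\<^esub> x) y' \<oplus>\<^bsub>L\<^esub> bracket L x (y' \<ominus>\<^bsub>L\<^esub> y)"
    proof -
      have "bracket L x' y' = bracket L (x' \<ominus>\<^bsub>L\<^esub> x) y' \<oplus>\<^bsub>L\<^esub> bracket L x y'"
        using xy xy' by (subst bracket_add_left[symmetric]) (auto simp: M.minus_eq M.a_assoc M.l_neg)
      moreover have "bracket L x y' = bracket L x (y' \<ominus>\<^bsub>L\<^esub> y) \<oplus>\<^bsub>L\<^esub> bracket L x y"
        using xy xy' by (subst bracket_add_right[symmetric]) (auto simp: M.minus_eq M.a_assoc M.l_neg)
      ultimately show ?thesis
        using xy xy' by (simp add: M.minus_eq M.a_assoc M.r_neg bracket_closed)
    qed
    also have "\<dots> \<in> I"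
      using xy xy' by (intro I.a_closed bracket_ideal bracket_ideal_left)
    finally show ?thesis using xy xy' by (subst coset_eq_iff) (auto simp: bracket_closed)
  qed
  moreover have "I +>\<^bsub>L\<^esub> x \<noteq> {}" "I +>\<^bsub>L\<^esub> y \<noteq> {}"
    using I.a_rcos_self[OF xy(1)] I.a_rcos_self[OF xy(2)] by blast+
  ultimately show "bracket (lie_quotient L I) (I +>\<^bsub>L\<^esub> x) (I +>\<^bsub>L\<^esub> y) = I +>\<^bsub>L\<^esub> bracket L x y"
    unfolding lie_quotient_def lie.simps by (intro SUP_eq_const)
next
  fix k x assume kx: "k \<in> carrier K" "x \<in> carrier L"
  have "I +>\<^bsub>L\<^esub> (k \<odot>\<^bsub>L\<^esub> x') = I +>\<^bsub>L\<^esub> (k \<odot>\<^bsub>L\<^esub> x)" if "x' \<in> I +>\<^bsub>L\<^esub> x" for x'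
  proof -
    note x' = mem_coset[OF kx(2) that]
    have "k \<odot>\<^bsub>L\<^esub> x' \<ominus>\<^bsub>L\<^esub> k \<odot>\<^bsub>L\<^esub> x = k \<odot>\<^bsub>L\<^esub> (x' \<ominus>\<^bsub>L\<^esub> x)"
      using kx x' by (simp add: M.minus_eq smult_r_distr smult_r_minus)
    then show ?thesis using kx x' by (subst coset_eq_iff) auto
  qed
  moreover have "I +>\<^bsub>L\<^esub> x \<noteq> {}" using I.a_rcos_self[OF kx(2)] by blast
  ultimately show "k \<odot>\<^bsub>lie_quotient L I\<^esub> (I +>\<^bsub>L\<^esub> x) = I +>\<^bsub>L\<^esub> (k \<odot>\<^bsub>L\<^esub> x)"
    unfolding lie_quotient_def module.simps by (intro SUP_eq_const)
qed

end


section \<open>The Lie algebra of derivations and its quotient by inner derivations\<close>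

context unital_algebra
begin

lemma derivationD:
  assumes "d \<in> derivations K A"
  shows "d \<in> extensional (carrier A)"
    and "x \<in> carrier A \<Longrightarrow> d x \<in> carrier A"
    and "\<lbrakk>x \<in> carrier A; y \<in> carrier A\<rbrakk> \<Longrightarrow> d (x \<oplus>\<^bsub>A\<^esub> y) = d x \<oplus>\<^bsub>A\<^esub> d y"
    and "\<lbrakk>k \<in> carrier K; x \<in> carrier A\<rbrakk> \<Longrightarrow> d (k \<odot>\<^bsub>A\<^esub> x) = k \<odot>\<^bsub>A\<^esub> d x"
    and "\<lbrakk>x \<in> carrier A; y \<in> carrier A\<rbrakk>
      \<Longrightarrow> d (x \<otimes>\<^bsub>A\<^esub> y) = d x \<otimes>\<^bsub>A\<^esub> y \<oplus>\<^bsub>A\<^esub> x \<otimes>\<^bsub>A\<^esub> d y"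
  using assms by (auto simp: derivations_def lin_End_def PiE_def Pi_def)

lemma derivationI:
  assumes "\<And>x. x \<in> carrier A \<Longrightarrow> g x \<in> carrier A"
    and "\<And>x y. \<lbrakk>x \<in> carrier A; y \<in> carrier A\<rbrakk> \<Longrightarrow> g (x \<oplus>\<^bsub>A\<^esub> y) = g x \<oplus>\<^bsub>A\<^esub> g y"
    and "\<And>k x. \<lbrakk>k \<in> carrier K; x \<in> carrier A\<rbrakk> \<Longrightarrow> g (k \<odot>\<^bsub>A\<^esub> x) = k \<odot>\<^bsub>A\<^esub> g x"
    and "\<And>x y. \<lbrakk>x \<in> carrier A; y \<in> carrier A\<rbrakk>
      \<Longrightarrow> g (x \<otimes>\<^bsub>A\<^esub> y) = g x \<otimes>\<^bsub>A\<^esub> y \<oplus>\<^bsub>A\<^esub> x \<otimes>\<^bsub>A\<^esub> g y"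
  shows "(\<lambda>x\<in>carrier A. g x) \<in> derivations K A"
  using assms by (auto simp: derivations_def lin_End_def)

lemma derivation_eqI:
  assumes "d \<in> derivations K A" "e \<in> derivations K A" "\<And>x. x \<in> carrier A \<Longrightarrow> d x = e x"
  shows "d = e"
  using assms derivationD(1) by (metis extensionalityI)

lemma derivation_zero:
  assumes "d \<in> derivations K A" shows "d \<zero>\<^bsub>A\<^esub> = \<zero>\<^bsub>A\<^esub>"
  using derivationD(3)[OF assms, of "\<zero>\<^bsub>A\<^esub>" "\<zero>\<^bsub>A\<^esub>"] derivationD(2)[OF assms, of "\<zero>\<^bsub>A\<^esub>"]
  by simp

lemma derivation_a_inv:
  assumes d: "d \<in> derivations K A" and x: "x \<in> carrier A" shows "d (\<ominus>\<^bsub>A\<^esub> x) = \<ominus>\<^bsub>A\<^esub> d x"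
  using derivationD(3)[OF d M.a_inv_closed[OF x] x] x
  by (intro M.minus_equality[symmetric])
    (simp_all add: M.l_neg derivation_zero[OF d] derivationD(2)[OF d])

lemma derivation_minus:
  assumes d: "d \<in> derivations K A" and "x \<in> carrier A" "y \<in> carrier A"
  shows "d (x \<ominus>\<^bsub>A\<^esub> y) = d x \<ominus>\<^bsub>A\<^esub> d y"
  using assms(2,3) by (simp add: M.minus_eq derivationD[OF d] derivation_a_inv[OF d])

lemmas derivation_simps = derivationD(2-5) derivation_zero derivation_a_inv derivation_minus

lemma smult_minus:
  "\<lbrakk>k \<in> carrier K; x \<in> carrier A; y \<in> carrier A\<rbrakk>
    \<Longrightarrow> k \<odot>\<^bsub>A\<^esub> (x \<ominus>\<^bsub>A\<^esub> y) = k \<odot>\<^bsub>A\<^esub> x \<ominus>\<^bsub>A\<^esub> k \<odot>\<^bsub>A\<^esub> y"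
  by (simp add: M.minus_eq smult_r_distr smult_r_minus)

lemma Der_simps:
  "carrier (Der K A) = derivations K A"
  "x \<in> carrier A \<Longrightarrow> \<zero>\<^bsub>Der K A\<^esub> x = \<zero>\<^bsub>A\<^esub>"
  "x \<in> carrier A \<Longrightarrow> (d \<oplus>\<^bsub>Der K A\<^esub> e) x = d x \<oplus>\<^bsub>A\<^esub> e x"
  "x \<in> carrier A \<Longrightarrow> (k \<odot>\<^bsub>Der K A\<^esub> d) x = k \<odot>\<^bsub>A\<^esub> d x"
  "x \<in> carrier A \<Longrightarrow> bracket (Der K A) d e x = d (e x) \<ominus>\<^bsub>A\<^esub> e (d x)"
  by (simp_all add: Der_def)

lemma Der_closed:
  "\<zero>\<^bsub>Der K A\<^esub> \<in> derivations K A"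
  "\<lbrakk>d \<in> derivations K A; e \<in> derivations K A\<rbrakk> \<Longrightarrow> d \<oplus>\<^bsub>Der K A\<^esub> e \<in> derivations K A"
  "\<lbrakk>k \<in> carrier K; d \<in> derivations K A\<rbrakk> \<Longrightarrow> k \<odot>\<^bsub>Der K A\<^esub> d \<in> derivations K A"
  "\<lbrakk>d \<in> derivations K A; e \<in> derivations K A\<rbrakk> \<Longrightarrow> bracket (Der K A) d e \<in> derivations K A"
proof -
  show "\<zero>\<^bsub>Der K A\<^esub> \<in> derivations K A"
    unfolding Der_def by simp (rule derivationI; simp)
next
  assume d: "d \<in> derivations K A" and e: "e \<in> derivations K A"
  note s = derivation_simps[OF d] derivation_simps[OF e]
  show "d \<oplus>\<^bsub>Der K A\<^esub> e \<in> derivations K A"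
    unfolding Der_def lie.simps module.simps ring.simps
    by (rule derivationI; simp add: s smult_r_distr;
        insert derivationD(2)[OF d] derivationD(2)[OF e]; algebra)
  show "bracket (Der K A) d e \<in> derivations K A"
    unfolding Der_def lie.simps module.simps ring.simps
    by (rule derivationI; simp add: s smult_minus;
        insert derivationD(2)[OF d] derivationD(2)[OF e]; algebra)
next
  assume k: "k \<in> carrier K" and d: "d \<in> derivations K A"
  show "k \<odot>\<^bsub>Der K A\<^esub> d \<in> derivations K A"
    unfolding Der_def lie.simps module.simps ring.simps
    by (rule derivationI; simp add: k derivation_simps[OF d] smult_r_distr smult_mult_left
        smult_mult_right smult_assoc1[symmetric] R.m_comm)
qed

lemma abelian_group_Der: "abelian_group (Der K A)"
proof (rule abelian_groupI; unfold Der_simps(1))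
  fix d assume d: "d \<in> derivations K A"
  note s = derivation_simps[OF d]
  let ?e = "\<lambda>x\<in>carrier A. \<ominus>\<^bsub>A\<^esub> d x"
  have e: "?e \<in> derivations K A"
    by (rule derivationI; simp add: s smult_r_minus; insert derivationD(2)[OF d]; algebra)
  have "?e \<oplus>\<^bsub>Der K A\<^esub> d = \<zero>\<^bsub>Der K A\<^esub>"
    by (rule derivation_eqI[OF Der_closed(2)[OF e d] Der_closed(1)]) (simp add: Der_simps s M.l_neg)
  with e show "\<exists>e\<in>derivations K A. e \<oplus>\<^bsub>Der K A\<^esub> d = \<zero>\<^bsub>Der K A\<^esub>" by blast
  show "\<zero>\<^bsub>Der K A\<^esub> \<oplus>\<^bsub>Der K A\<^esub> d = d"
    by (rule derivation_eqI[OF Der_closed(2)[OF Der_closed(1) d] d]) (simp add: Der_simps s)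
  fix e assume e: "e \<in> derivations K A"
  note s = s derivation_simps[OF e]
  show "d \<oplus>\<^bsub>Der K A\<^esub> e = e \<oplus>\<^bsub>Der K A\<^esub> d"
    by (rule derivation_eqI[OF Der_closed(2)[OF d e] Der_closed(2)[OF e d]])
      (simp add: Der_simps s M.a_comm)
  fix f assume f: "f \<in> derivations K A"
  note s = s derivation_simps[OF f]
  show "d \<oplus>\<^bsub>Der K A\<^esub> e \<oplus>\<^bsub>Der K A\<^esub> f = d \<oplus>\<^bsub>Der K A\<^esub> (e \<oplus>\<^bsub>Der K A\<^esub> f)"
    by (rule derivation_eqI) (simp_all add: Der_closed d e f Der_simps s M.a_assoc)
qed (simp_all add: Der_closed)

lemma lie_algebra_Der: "lie_algebra K (Der K A)"
proof -
  have "module K (Der K A)"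
  proof (rule moduleI[OF R.is_cring abelian_group_Der]; unfold Der_simps(1))
    fix d assume d: "d \<in> derivations K A"
    note s = derivation_simps[OF d]
    show "\<one>\<^bsub>K\<^esub> \<odot>\<^bsub>Der K A\<^esub> d = d"
      by (rule derivation_eqI) (simp_all add: Der_closed d Der_simps s)
    fix k assume k: "k \<in> carrier K"
    show "k \<odot>\<^bsub>Der K A\<^esub> d \<in> derivations K A" using k d by (rule Der_closed)
    {
      fix l assume l: "l \<in> carrier K"
      show "(k \<oplus>\<^bsub>K\<^esub> l) \<odot>\<^bsub>Der K A\<^esub> d = k \<odot>\<^bsub>Der K A\<^esub> d \<oplus>\<^bsub>Der K A\<^esub> l \<odot>\<^bsub>Der K A\<^esub> d"
        by (rule derivation_eqI) (simp_all add: Der_closed d k l Der_simps s smult_l_distr)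
      show "(k \<otimes>\<^bsub>K\<^esub> l) \<odot>\<^bsub>Der K A\<^esub> d = k \<odot>\<^bsub>Der K A\<^esub> (l \<odot>\<^bsub>Der K A\<^esub> d)"
        by (rule derivation_eqI) (simp_all add: Der_closed d k l Der_simps s smult_assoc1)
    }
    fix e assume e: "e \<in> derivations K A"
    show "k \<odot>\<^bsub>Der K A\<^esub> (d \<oplus>\<^bsub>Der K A\<^esub> e) = k \<odot>\<^bsub>Der K A\<^esub> d \<oplus>\<^bsub>Der K A\<^esub> k \<odot>\<^bsub>Der K A\<^esub> e"
      by (rule derivation_eqI)
        (simp_all add: Der_closed d k e Der_simps s derivation_simps[OF e] smult_r_distr)
  qed
  moreover have "lie_algebra_axioms K (Der K A)"
  proof (unfold_locales; unfold Der_simps(1))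
    fix d assume d: "d \<in> derivations K A"
    note s = derivation_simps[OF d]
    show "bracket (Der K A) d d = \<zero>\<^bsub>Der K A\<^esub>"
      by (rule derivation_eqI) (simp_all add: Der_closed d Der_simps s M.minus_eq M.r_neg)
    fix e assume e: "e \<in> derivations K A"
    note s = s derivation_simps[OF e]
    show "bracket (Der K A) d e \<in> derivations K A" using d e by (rule Der_closed)
    {
      fix k assume k: "k \<in> carrier K"
      show "bracket (Der K A) (k \<odot>\<^bsub>Der K A\<^esub> d) e = k \<odot>\<^bsub>Der K A\<^esub> bracket (Der K A) d e"
        by (rule derivation_eqI) (simp_all add: Der_closed d e k Der_simps s smult_minus)
      show "bracket (Der K A) d (k \<odot>\<^bsub>Der K A\<^esub> e) = k \<odot>\<^bsub>Der K A\<^esub> bracket (Der K A) d e"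
        by (rule derivation_eqI) (simp_all add: Der_closed d e k Der_simps s smult_minus)
    }
    fix f assume f: "f \<in> derivations K A"
    note s = s derivation_simps[OF f]
    show "bracket (Der K A) (d \<oplus>\<^bsub>Der K A\<^esub> e) f
        = bracket (Der K A) d f \<oplus>\<^bsub>Der K A\<^esub> bracket (Der K A) e f"
      by (rule derivation_eqI; simp add: Der_closed d e f Der_simps s;
          insert derivationD(2)[OF d] derivationD(2)[OF e] derivationD(2)[OF f]; algebra)
    show "bracket (Der K A) d (e \<oplus>\<^bsub>Der K A\<^esub> f)
        = bracket (Der K A) d e \<oplus>\<^bsub>Der K A\<^esub> bracket (Der K A) d f"
      by (rule derivation_eqI; simp add: Der_closed d e f Der_simps s;
          insert derivationD(2)[OF d] derivationD(2)[OF e] derivationD(2)[OF f]; algebra)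
    show "bracket (Der K A) d (bracket (Der K A) e f)
        \<oplus>\<^bsub>Der K A\<^esub> bracket (Der K A) e (bracket (Der K A) f d)
        \<oplus>\<^bsub>Der K A\<^esub> bracket (Der K A) f (bracket (Der K A) d e) = \<zero>\<^bsub>Der K A\<^esub>"
      by (rule derivation_eqI; simp add: Der_closed d e f Der_simps s;
          insert derivationD(2)[OF d] derivationD(2)[OF e] derivationD(2)[OF f]; algebra)
  qed
  ultimately show ?thesis by (rule lie_algebra.intro)
qed

sublocale Der: lie_algebra K "Der K A"
  by (rule lie_algebra_Der)

lemma Der_a_inv:
  assumes d: "d \<in> derivations K A" and x: "x \<in> carrier A"
  shows "(\<ominus>\<^bsub>Der K A\<^esub> d) x = \<ominus>\<^bsub>A\<^esub> d x"
proof -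
  have d': "d \<in> carrier (Der K A)" "\<ominus>\<^bsub>Der K A\<^esub> d \<in> derivations K A"
    using d Der.M.a_inv_closed by (auto simp: Der_simps)
  then have "(\<ominus>\<^bsub>Der K A\<^esub> d \<oplus>\<^bsub>Der K A\<^esub> d) x = \<zero>\<^bsub>Der K A\<^esub> x" by (simp add: Der.M.l_neg)
  then show ?thesis
    using x derivation_simps(1)[OF d x] derivation_simps(1)[OF d'(2) x]
    by (intro M.minus_equality[symmetric]) (simp_all add: Der_simps)
qed

lemma Der_minus:
  assumes "d \<in> derivations K A" "e \<in> derivations K A" "x \<in> carrier A"
  shows "(d \<ominus>\<^bsub>Der K A\<^esub> e) x = d x \<ominus>\<^bsub>A\<^esub> e x"
  using assms by (simp add: Der.M.minus_eq M.minus_eq Der_simps Der_a_inv)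

lemma Der_minus_closed:
  "\<lbrakk>d \<in> derivations K A; e \<in> derivations K A\<rbrakk> \<Longrightarrow> d \<ominus>\<^bsub>Der K A\<^esub> e \<in> derivations K A"
  "d \<in> derivations K A \<Longrightarrow> \<ominus>\<^bsub>Der K A\<^esub> d \<in> derivations K A"
  using Der.M.minus_closed Der.M.a_inv_closed by (auto simp: Der_simps)

definition ad :: "'a \<Rightarrow> 'a \<Rightarrow> 'a"
  where "ad t = (\<lambda>x\<in>carrier A. t \<otimes>\<^bsub>A\<^esub> x \<ominus>\<^bsub>A\<^esub> x \<otimes>\<^bsub>A\<^esub> t)"

lemma ad_apply: "x \<in> carrier A \<Longrightarrow> ad t x = t \<otimes>\<^bsub>A\<^esub> x \<ominus>\<^bsub>A\<^esub> x \<otimes>\<^bsub>A\<^esub> t"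
  by (simp add: ad_def)

lemma Int_der_eq: "Int_der A = ad ` carrier A"
  by (simp add: Int_der_def ad_def)

lemma ad_derivation: "t \<in> carrier A \<Longrightarrow> ad t \<in> derivations K A"
  unfolding ad_def
  by (rule derivationI; (simp add: smult_minus smult_mult_left smult_mult_right)?; algebra?)

lemma lie_ideal_Int: "lie_ideal (Int_der A) K (Der K A)"
proof -
  have "submodule (Int_der A) K (Der K A)"
  proof (rule Der.submoduleI)
    show "Int_der A \<subseteq> carrier (Der K A)" using ad_derivation by (auto simp: Der_simps Int_der_eq)
    have "\<zero>\<^bsub>Der K A\<^esub> = ad \<zero>\<^bsub>A\<^esub>"
      by (rule derivation_eqI) (simp_all add: Der_closed ad_derivation Der_simps ad_apply M.minus_eq)
    then show "\<zero>\<^bsub>Der K A\<^esub> \<in> Int_der A" by (auto simp: Int_der_eq)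
  next
    fix d assume "d \<in> Int_der A"
    then obtain t where t: "t \<in> carrier A" "d = ad t" by (auto simp: Int_der_eq)
    have "\<ominus>\<^bsub>Der K A\<^esub> d = ad (\<ominus>\<^bsub>A\<^esub> t)" unfolding t(2)
      by (rule derivation_eqI; simp add: Der_minus_closed ad_derivation t(1) Der_a_inv ad_apply;
          insert t(1); algebra)
    then show "\<ominus>\<^bsub>Der K A\<^esub> d \<in> Int_der A" using t by (auto simp: Int_der_eq)
  next
    fix d e assume "d \<in> Int_der A" "e \<in> Int_der A"
    then obtain t u where t: "t \<in> carrier A" "d = ad t" "u \<in> carrier A" "e = ad u"
      by (auto simp: Int_der_eq)
    have "d \<oplus>\<^bsub>Der K A\<^esub> e = ad (t \<oplus>\<^bsub>A\<^esub> u)" unfolding t(2,4)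
      by (rule derivation_eqI; simp add: Der_closed ad_derivation t(1,3) Der_simps ad_apply;
          insert t(1,3); algebra)
    then show "d \<oplus>\<^bsub>Der K A\<^esub> e \<in> Int_der A" using t by (auto simp: Int_der_eq)
  next
    fix k d assume k: "k \<in> carrier K" and "d \<in> Int_der A"
    then obtain t where t: "t \<in> carrier A" "d = ad t" by (auto simp: Int_der_eq)
    have "k \<odot>\<^bsub>Der K A\<^esub> d = ad (k \<odot>\<^bsub>A\<^esub> t)" unfolding t(2)
      by (rule derivation_eqI)
        (simp_all add: Der_closed ad_derivation t(1) k Der_simps ad_apply smult_minus
          smult_mult_left smult_mult_right)
    then show "k \<odot>\<^bsub>Der K A\<^esub> d \<in> Int_der A" using t k by (auto simp: Int_der_eq)
  qed
  moreover have "lie_ideal_axioms (Int_der A) (Der K A)"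
  proof (unfold_locales; unfold Der_simps(1))
    fix d e assume d: "d \<in> derivations K A" and "e \<in> Int_der A"
    then obtain t where t: "t \<in> carrier A" "e = ad t" by (auto simp: Int_der_eq)
    note s = derivation_simps[OF d]
    have "bracket (Der K A) d e = ad (d t)" unfolding t(2)
      by (rule derivation_eqI; simp add: Der_closed d ad_derivation t(1) Der_simps ad_apply s;
          insert t(1) derivationD(2)[OF d]; algebra)
    then show "bracket (Der K A) d e \<in> Int_der A"
      using t s by (auto simp: Int_der_eq)
  qed
  ultimately show ?thesis using lie_algebra_Der by (intro lie_ideal.intro)
qed

sublocale Int: lie_ideal "Int_der A" K "Der K A"
  by (rule lie_ideal_Int)

lemma HH1_class_eq_iff:
  assumes "d \<in> derivations K A" "e \<in> derivations K A"
  shows "HH1_class K A d = HH1_class K A e \<longleftrightarrow> d \<ominus>\<^bsub>Der K A\<^esub> e \<in> Int_der A"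
  using Int.coset_eq_iff[of d e] assms by (simp add: HH1_class_def Der_simps)

lemma HH1_class_self: "d \<in> derivations K A \<Longrightarrow> d \<in> HH1_class K A d"
  using Int.I.a_rcos_self[of d] by (simp add: HH1_class_def Der_simps)

lemma mem_HH1_classD:
  assumes d: "d \<in> derivations K A" and e: "e \<in> HH1_class K A d"
  shows "e \<in> derivations K A" and "HH1_class K A e = HH1_class K A d"
proof -
  show "e \<in> derivations K A"
    using Int.mem_coset(1)[of d e] d e by (simp add: HH1_class_def Der_simps)
  then show "HH1_class K A e = HH1_class K A d"
    using Int.mem_coset(2)[of d e] d e HH1_class_eq_iff by (simp add: HH1_class_def Der_simps)
qed

lemma HH1_class_add_ad:
  assumes d: "d \<in> derivations K A" and t: "t \<in> carrier A"
  shows "HH1_class K A (d \<oplus>\<^bsub>Der K A\<^esub> ad t) = HH1_class K A d"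
proof -
  have "d \<oplus>\<^bsub>Der K A\<^esub> ad t \<ominus>\<^bsub>Der K A\<^esub> d = ad t"
    using d ad_derivation[OF t] Der_minus_closed(2)[OF d]
    by (simp add: Der.M.minus_eq Der.M.a_comm[of d] Der.M.a_assoc Der.M.r_neg Der_simps)
  then show ?thesis
    using t by (simp add: HH1_class_eq_iff d Der_closed ad_derivation Int_der_eq)
qed

lemma carrier_HH1: "carrier (HH1 K A) = HH1_class K A ` derivations K A"
  using Int.quotient.image_carrier by (simp add: HH1_def HH1_class_def Der_simps)

lemma HH1_class_simps:
  "\<lbrakk>d \<in> derivations K A; e \<in> derivations K A\<rbrakk>
    \<Longrightarrow> HH1_class K A d \<oplus>\<^bsub>HH1 K A\<^esub> HH1_class K A e = HH1_class K A (d \<oplus>\<^bsub>Der K A\<^esub> e)"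
  "\<lbrakk>k \<in> carrier K; d \<in> derivations K A\<rbrakk>
    \<Longrightarrow> k \<odot>\<^bsub>HH1 K A\<^esub> HH1_class K A d = HH1_class K A (k \<odot>\<^bsub>Der K A\<^esub> d)"
  "\<lbrakk>d \<in> derivations K A; e \<in> derivations K A\<rbrakk>
    \<Longrightarrow> bracket (HH1 K A) (HH1_class K A d) (HH1_class K A e)
      = HH1_class K A (bracket (Der K A) d e)"
  using Int.quotient.hom_simps by (auto simp: HH1_def HH1_class_def Der_simps)

lemma lie_subalgebra_classes:
  "lie_subalgebra D K (Der K A) \<Longrightarrow> lie_subalgebra (HH1_class K A ` D) K (HH1 K A)"
  using Int.quotient.lie_subalgebra_image by (simp add: HH1_def HH1_class_def[abs_def])

end


section \<open>Derivations of split extensions with kernel of square zero\<close>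

locale split_square_zero = T: unital_algebra K T + S: unital_algebra K S
  for K :: "'k ring" and T :: "('k, 't) module" and S :: "('k, 's) module" +
  fixes \<pi> :: "'t \<Rightarrow> 's" and \<iota> :: "'s \<Rightarrow> 't"
  assumes proj_closed: "x \<in> carrier T \<Longrightarrow> \<pi> x \<in> carrier S"
    and proj_add: "\<lbrakk>x \<in> carrier T; y \<in> carrier T\<rbrakk> \<Longrightarrow> \<pi> (x \<oplus>\<^bsub>T\<^esub> y) = \<pi> x \<oplus>\<^bsub>S\<^esub> \<pi> y"
    and proj_smult: "\<lbrakk>k \<in> carrier K; x \<in> carrier T\<rbrakk> \<Longrightarrow> \<pi> (k \<odot>\<^bsub>T\<^esub> x) = k \<odot>\<^bsub>S\<^esub> \<pi> x"
    and proj_mult: "\<lbrakk>x \<in> carrier T; y \<in> carrier T\<rbrakk> \<Longrightarrow> \<pi> (x \<otimes>\<^bsub>T\<^esub> y) = \<pi> x \<otimes>\<^bsub>S\<^esub> \<pi> y"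
    and incl_closed: "s \<in> carrier S \<Longrightarrow> \<iota> s \<in> carrier T"
    and incl_add: "\<lbrakk>s \<in> carrier S; t \<in> carrier S\<rbrakk> \<Longrightarrow> \<iota> (s \<oplus>\<^bsub>S\<^esub> t) = \<iota> s \<oplus>\<^bsub>T\<^esub> \<iota> t"
    and incl_smult: "\<lbrakk>k \<in> carrier K; s \<in> carrier S\<rbrakk> \<Longrightarrow> \<iota> (k \<odot>\<^bsub>S\<^esub> s) = k \<odot>\<^bsub>T\<^esub> \<iota> s"
    and incl_mult: "\<lbrakk>s \<in> carrier S; t \<in> carrier S\<rbrakk> \<Longrightarrow> \<iota> (s \<otimes>\<^bsub>S\<^esub> t) = \<iota> s \<otimes>\<^bsub>T\<^esub> \<iota> t"
    and proj_incl: "s \<in> carrier S \<Longrightarrow> \<pi> (\<iota> s) = s"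
    and square_zero: "\<lbrakk>x \<in> carrier T; y \<in> carrier T; \<pi> x = \<zero>\<^bsub>S\<^esub>; \<pi> y = \<zero>\<^bsub>S\<^esub>\<rbrakk>
      \<Longrightarrow> x \<otimes>\<^bsub>T\<^esub> y = \<zero>\<^bsub>T\<^esub>"
begin

lemma proj_zero: "\<pi> \<zero>\<^bsub>T\<^esub> = \<zero>\<^bsub>S\<^esub>"
  using proj_add[of "\<zero>\<^bsub>T\<^esub>" "\<zero>\<^bsub>T\<^esub>"] proj_closed[of "\<zero>\<^bsub>T\<^esub>"] by simp

lemma proj_a_inv:
  assumes x: "x \<in> carrier T" shows "\<pi> (\<ominus>\<^bsub>T\<^esub> x) = \<ominus>\<^bsub>S\<^esub> \<pi> x"
  using proj_add[OF T.M.a_inv_closed[OF x] x] x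
  by (intro S.M.minus_equality[symmetric]) (simp_all add: T.M.l_neg proj_zero proj_closed)

lemma proj_minus:
  "\<lbrakk>x \<in> carrier T; y \<in> carrier T\<rbrakk> \<Longrightarrow> \<pi> (x \<ominus>\<^bsub>T\<^esub> y) = \<pi> x \<ominus>\<^bsub>S\<^esub> \<pi> y"
  by (simp add: T.M.minus_eq S.M.minus_eq proj_add proj_a_inv)

lemma incl_zero: "\<iota> \<zero>\<^bsub>S\<^esub> = \<zero>\<^bsub>T\<^esub>"
  using incl_add[of "\<zero>\<^bsub>S\<^esub>" "\<zero>\<^bsub>S\<^esub>"] incl_closed[of "\<zero>\<^bsub>S\<^esub>"] by simp

lemma incl_a_inv:
  assumes s: "s \<in> carrier S" shows "\<iota> (\<ominus>\<^bsub>S\<^esub> s) = \<ominus>\<^bsub>T\<^esub> \<iota> s"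
  using incl_add[OF S.M.a_inv_closed[OF s] s] s
  by (intro T.M.minus_equality[symmetric]) (simp_all add: S.M.l_neg incl_zero incl_closed)

lemma incl_minus:
  "\<lbrakk>s \<in> carrier S; t \<in> carrier S\<rbrakk> \<Longrightarrow> \<iota> (s \<ominus>\<^bsub>S\<^esub> t) = \<iota> s \<ominus>\<^bsub>T\<^esub> \<iota> t"
  by (simp add: T.M.minus_eq S.M.minus_eq incl_add incl_a_inv)

lemmas proj_simps = proj_closed proj_add proj_smult proj_mult proj_zero proj_minus
lemmas incl_simps = incl_closed incl_add incl_smult incl_mult incl_zero incl_minus proj_incl

definition \<theta> :: "'t \<Rightarrow> 't" where "\<theta> x = \<iota> (\<pi> x)"

lemma \<theta>_simps:
  "x \<in> carrier T \<Longrightarrow> \<theta> x \<in> carrier T"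
  "\<lbrakk>x \<in> carrier T; y \<in> carrier T\<rbrakk> \<Longrightarrow> \<theta> (x \<oplus>\<^bsub>T\<^esub> y) = \<theta> x \<oplus>\<^bsub>T\<^esub> \<theta> y"
  "\<lbrakk>k \<in> carrier K; x \<in> carrier T\<rbrakk> \<Longrightarrow> \<theta> (k \<odot>\<^bsub>T\<^esub> x) = k \<odot>\<^bsub>T\<^esub> \<theta> x"
  "\<lbrakk>x \<in> carrier T; y \<in> carrier T\<rbrakk> \<Longrightarrow> \<theta> (x \<otimes>\<^bsub>T\<^esub> y) = \<theta> x \<otimes>\<^bsub>T\<^esub> \<theta> y"
  "\<theta> \<zero>\<^bsub>T\<^esub> = \<zero>\<^bsub>T\<^esub>"
  "\<lbrakk>x \<in> carrier T; y \<in> carrier T\<rbrakk> \<Longrightarrow> \<theta> (x \<ominus>\<^bsub>T\<^esub> y) = \<theta> x \<ominus>\<^bsub>T\<^esub> \<theta> y"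
  "x \<in> carrier T \<Longrightarrow> \<theta> (\<ominus>\<^bsub>T\<^esub> x) = \<ominus>\<^bsub>T\<^esub> \<theta> x"
  "x \<in> carrier T \<Longrightarrow> \<theta> (\<theta> x) = \<theta> x"
  by (simp_all add: \<theta>_def proj_simps incl_simps proj_a_inv incl_a_inv)

lemma proj_\<theta>: "x \<in> carrier T \<Longrightarrow> \<pi> (\<theta> x) = \<pi> x"
  by (simp add: \<theta>_def proj_simps incl_simps)

lemma \<theta>_incl: "s \<in> carrier S \<Longrightarrow> \<theta> (\<iota> s) = \<iota> s"
  by (simp add: \<theta>_def proj_simps incl_simps)

lemma kernel_mult_zero:
  assumes "x \<in> carrier T" "y \<in> carrier T"
  shows "(x \<ominus>\<^bsub>T\<^esub> \<theta> x) \<otimes>\<^bsub>T\<^esub> (y \<ominus>\<^bsub>T\<^esub> \<theta> y) = \<zero>\<^bsub>T\<^esub>"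
  using assms
  by (intro square_zero) (auto simp: \<theta>_simps proj_simps proj_\<theta> S.M.minus_eq S.M.r_neg)

text \<open>
  Elements \<open>x - \<theta> x\<close> lie in the kernel, so only the \<open>\<theta>\<close>-part of the other factor survives.
\<close>

lemma kernel_mult_left:
  assumes x: "x \<in> carrier T" and y: "y \<in> carrier T"
  shows "(x \<ominus>\<^bsub>T\<^esub> \<theta> x) \<otimes>\<^bsub>T\<^esub> y = (x \<ominus>\<^bsub>T\<^esub> \<theta> x) \<otimes>\<^bsub>T\<^esub> \<theta> y"
proof -
  let ?u = "x \<ominus>\<^bsub>T\<^esub> \<theta> x"
  have c: "?u \<in> carrier T" "y \<in> carrier T" "\<theta> y \<in> carrier T" using x y by (auto simp: \<theta>_simps)
  then have "?u \<otimes>\<^bsub>T\<^esub> y = ?u \<otimes>\<^bsub>T\<^esub> (y \<ominus>\<^bsub>T\<^esub> \<theta> y) \<oplus>\<^bsub>T\<^esub> ?u \<otimes>\<^bsub>T\<^esub> \<theta> y"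
    by (subst T.A.r_distr[symmetric]) (auto simp: T.M.minus_eq T.M.a_assoc T.M.l_neg)
  then show ?thesis using kernel_mult_zero[OF x y] c by simp
qed

lemma kernel_mult_right:
  assumes x: "x \<in> carrier T" and y: "y \<in> carrier T"
  shows "x \<otimes>\<^bsub>T\<^esub> (y \<ominus>\<^bsub>T\<^esub> \<theta> y) = \<theta> x \<otimes>\<^bsub>T\<^esub> (y \<ominus>\<^bsub>T\<^esub> \<theta> y)"
proof -
  let ?v = "y \<ominus>\<^bsub>T\<^esub> \<theta> y"
  have c: "?v \<in> carrier T" "x \<in> carrier T" "\<theta> x \<in> carrier T" using x y by (auto simp: \<theta>_simps)
  then have "x \<otimes>\<^bsub>T\<^esub> ?v = (x \<ominus>\<^bsub>T\<^esub> \<theta> x) \<otimes>\<^bsub>T\<^esub> ?v \<oplus>\<^bsub>T\<^esub> \<theta> x \<otimes>\<^bsub>T\<^esub> ?v"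
    by (subst T.A.l_distr[symmetric]) (auto simp: T.M.minus_eq T.M.a_assoc T.M.l_neg)
  then show ?thesis using kernel_mult_zero[OF x y] c by simp
qed

text \<open>
  The block \<open>(1 - \<theta>) d \<theta>\<close> of \<open>d\<close>.
\<close>

definition to_kernel :: "('t \<Rightarrow> 't) \<Rightarrow> 't \<Rightarrow> 't"
  where "to_kernel d = (\<lambda>x\<in>carrier T. d (\<theta> x) \<ominus>\<^bsub>T\<^esub> \<theta> (d (\<theta> x)))"

text \<open>
  The block \<open>\<theta> d (1 - \<theta>)\<close> of \<open>d\<close>.
\<close>

definition from_kernel :: "('t \<Rightarrow> 't) \<Rightarrow> 't \<Rightarrow> 't"
  where "from_kernel d = (\<lambda>x\<in>carrier T. \<theta> (d x) \<ominus>\<^bsub>T\<^esub> \<theta> (d (\<theta> x)))"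

text \<open>
  \<open>(1 - \<theta>) d \<theta>\<close> satisfies the Leibniz rule with \<open>\<theta> x\<close> and \<open>\<theta> y\<close> as coefficients, because \<open>\<theta>\<close> is
  multiplicative. As its values lie in the kernel, whose square is zero, the coefficients may be
  replaced by \<open>x\<close> and \<open>y\<close>.
\<close>

lemma to_kernel_derivation:
  assumes d: "d \<in> derivations K T" shows "to_kernel d \<in> derivations K T"
  unfolding to_kernel_def
proof (rule T.derivationI)
  note s = T.derivation_simps[OF d]
  fix x assume x: "x \<in> carrier T"
  show "d (\<theta> x) \<ominus>\<^bsub>T\<^esub> \<theta> (d (\<theta> x)) \<in> carrier T"
    using x by (simp add: s \<theta>_simps)
  {
    fix k assume "k \<in> carrier K"
    then show "d (\<theta> (k \<odot>\<^bsub>T\<^esub> x)) \<ominus>\<^bsub>T\<^esub> \<theta> (d (\<theta> (k \<odot>\<^bsub>T\<^esub> x)))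
        = k \<odot>\<^bsub>T\<^esub> (d (\<theta> x) \<ominus>\<^bsub>T\<^esub> \<theta> (d (\<theta> x)))"
      using x by (simp add: s \<theta>_simps T.smult_minus)
  }
  fix y assume y: "y \<in> carrier T"
  have c: "x \<in> carrier T" "y \<in> carrier T" "\<theta> x \<in> carrier T" "\<theta> y \<in> carrier T"
    "d (\<theta> x) \<in> carrier T" "d (\<theta> y) \<in> carrier T"
    "\<theta> (d (\<theta> x)) \<in> carrier T" "\<theta> (d (\<theta> y)) \<in> carrier T"
    using x y by (simp_all add: s \<theta>_simps)
  show "d (\<theta> (x \<oplus>\<^bsub>T\<^esub> y)) \<ominus>\<^bsub>T\<^esub> \<theta> (d (\<theta> (x \<oplus>\<^bsub>T\<^esub> y)))
      = d (\<theta> x) \<ominus>\<^bsub>T\<^esub> \<theta> (d (\<theta> x)) \<oplus>\<^bsub>T\<^esub> (d (\<theta> y) \<ominus>\<^bsub>T\<^esub> \<theta> (d (\<theta> y)))"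
    by (simp add: c s \<theta>_simps, insert c, algebra)
  show "d (\<theta> (x \<otimes>\<^bsub>T\<^esub> y)) \<ominus>\<^bsub>T\<^esub> \<theta> (d (\<theta> (x \<otimes>\<^bsub>T\<^esub> y)))
      = (d (\<theta> x) \<ominus>\<^bsub>T\<^esub> \<theta> (d (\<theta> x))) \<otimes>\<^bsub>T\<^esub> y \<oplus>\<^bsub>T\<^esub> x \<otimes>\<^bsub>T\<^esub> (d (\<theta> y) \<ominus>\<^bsub>T\<^esub> \<theta> (d (\<theta> y)))"
    by (simp add: c s \<theta>_simps kernel_mult_left[OF c(5) c(2)] kernel_mult_right[OF c(1) c(6)],
        insert c, algebra)
qed

text \<open>
  Here the values \<open>p = \<theta> d u\<close> and \<open>q = \<theta> d v\<close>, with \<open>u\<close> and \<open>v\<close> the kernel parts of \<open>x\<close> and \<open>y\<close>, are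
  not in the kernel, and replacing \<open>\<theta> x\<close>, \<open>\<theta> y\<close> by \<open>x\<close>, \<open>y\<close> costs \<open>p v + u q\<close>. This is zero: it equals
  \<open>d u v + u d v = d (u v)\<close>, since \<open>p\<close> and \<open>d u\<close> differ by a kernel element, and \<open>u v = 0\<close>.
\<close>

lemma from_kernel_derivation:
  assumes d: "d \<in> derivations K T" shows "from_kernel d \<in> derivations K T"
  unfolding from_kernel_def
proof (rule T.derivationI)
  note s = T.derivation_simps[OF d]
  fix x assume x: "x \<in> carrier T"
  show "\<theta> (d x) \<ominus>\<^bsub>T\<^esub> \<theta> (d (\<theta> x)) \<in> carrier T"
    using x by (simp add: s \<theta>_simps)
  {
    fix k assume "k \<in> carrier K"
    then show "\<theta> (d (k \<odot>\<^bsub>T\<^esub> x)) \<ominus>\<^bsub>T\<^esub> \<theta> (d (\<theta> (k \<odot>\<^bsub>T\<^esub> x)))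
        = k \<odot>\<^bsub>T\<^esub> (\<theta> (d x) \<ominus>\<^bsub>T\<^esub> \<theta> (d (\<theta> x)))"
      using x by (simp add: s \<theta>_simps T.smult_minus)
  }
  fix y assume y: "y \<in> carrier T"
  define u where "u = x \<ominus>\<^bsub>T\<^esub> \<theta> x"
  define v where "v = y \<ominus>\<^bsub>T\<^esub> \<theta> y"
  define p where "p = \<theta> (d x) \<ominus>\<^bsub>T\<^esub> \<theta> (d (\<theta> x))"
  define q where "q = \<theta> (d y) \<ominus>\<^bsub>T\<^esub> \<theta> (d (\<theta> y))"
  have c: "x \<in> carrier T" "y \<in> carrier T" "\<theta> x \<in> carrier T" "\<theta> y \<in> carrier T"
    "\<theta> (d x) \<in> carrier T" "\<theta> (d y) \<in> carrier T"
    "\<theta> (d (\<theta> x)) \<in> carrier T" "\<theta> (d (\<theta> y)) \<in> carrier T"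
    using x y by (simp_all add: s \<theta>_simps)
  have uv: "u \<in> carrier T" "v \<in> carrier T" "p \<in> carrier T" "q \<in> carrier T"
    "d u \<in> carrier T" "d v \<in> carrier T"
    using c by (simp_all add: u_def v_def p_def q_def s)
  have pq: "p = \<theta> (d u)" "q = \<theta> (d v)"
    using x y by (simp_all add: p_def q_def u_def v_def s \<theta>_simps)
  have \<theta>0: "\<theta> u = \<zero>\<^bsub>T\<^esub>" "\<theta> v = \<zero>\<^bsub>T\<^esub>"
    using x y by (simp_all add: u_def v_def \<theta>_simps T.M.minus_eq T.M.r_neg)
  show "\<theta> (d (x \<oplus>\<^bsub>T\<^esub> y)) \<ominus>\<^bsub>T\<^esub> \<theta> (d (\<theta> (x \<oplus>\<^bsub>T\<^esub> y)))
      = \<theta> (d x) \<ominus>\<^bsub>T\<^esub> \<theta> (d (\<theta> x)) \<oplus>\<^bsub>T\<^esub> (\<theta> (d y) \<ominus>\<^bsub>T\<^esub> \<theta> (d (\<theta> y)))"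
    by (simp add: c s \<theta>_simps, insert c, algebra)
  have "d (u \<otimes>\<^bsub>T\<^esub> v) = \<zero>\<^bsub>T\<^esub>"
    using kernel_mult_zero[OF x y] by (simp add: u_def v_def s)
  then have "d u \<otimes>\<^bsub>T\<^esub> v \<oplus>\<^bsub>T\<^esub> u \<otimes>\<^bsub>T\<^esub> d v = \<zero>\<^bsub>T\<^esub>" by (simp add: s uv)
  moreover have "d u \<otimes>\<^bsub>T\<^esub> v = p \<otimes>\<^bsub>T\<^esub> v"
  proof -
    have "(d u \<ominus>\<^bsub>T\<^esub> p) \<otimes>\<^bsub>T\<^esub> v = \<zero>\<^bsub>T\<^esub>"
      using kernel_mult_left[OF uv(5) uv(2)] uv by (simp add: pq \<theta>0 \<theta>_simps)
    then show ?thesis using uv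
      by (simp add: T.M.minus_eq T.A.l_distr T.A.l_minus)
         (metis T.A.m_closed T.M.minus_equality T.M.minus_minus T.M.a_inv_closed)
  qed
  moreover have "u \<otimes>\<^bsub>T\<^esub> d v = u \<otimes>\<^bsub>T\<^esub> q"
  proof -
    have "u \<otimes>\<^bsub>T\<^esub> (d v \<ominus>\<^bsub>T\<^esub> q) = \<zero>\<^bsub>T\<^esub>"
      using kernel_mult_right[OF uv(1) uv(6)] uv by (simp add: pq \<theta>0 \<theta>_simps)
    then show ?thesis using uv
      by (simp add: T.M.minus_eq T.A.r_distr T.A.r_minus)
         (metis T.A.m_closed T.M.minus_equality T.M.minus_minus T.M.a_inv_closed)
  qed
  ultimately have cancel: "p \<otimes>\<^bsub>T\<^esub> v \<oplus>\<^bsub>T\<^esub> u \<otimes>\<^bsub>T\<^esub> q = \<zero>\<^bsub>T\<^esub>" by simp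
  have "p \<otimes>\<^bsub>T\<^esub> y \<oplus>\<^bsub>T\<^esub> x \<otimes>\<^bsub>T\<^esub> q
      = p \<otimes>\<^bsub>T\<^esub> \<theta> y \<oplus>\<^bsub>T\<^esub> \<theta> x \<otimes>\<^bsub>T\<^esub> q \<oplus>\<^bsub>T\<^esub> (p \<otimes>\<^bsub>T\<^esub> v \<oplus>\<^bsub>T\<^esub> u \<otimes>\<^bsub>T\<^esub> q)"
    unfolding u_def v_def using c(1-4) uv(3,4) by algebra
  also have "\<dots> = p \<otimes>\<^bsub>T\<^esub> \<theta> y \<oplus>\<^bsub>T\<^esub> \<theta> x \<otimes>\<^bsub>T\<^esub> q" using cancel c uv by simp
  also have "\<dots> = \<theta> (d (x \<otimes>\<^bsub>T\<^esub> y)) \<ominus>\<^bsub>T\<^esub> \<theta> (d (\<theta> (x \<otimes>\<^bsub>T\<^esub> y)))"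
    unfolding p_def q_def by (simp add: c s \<theta>_simps, insert c, algebra)
  finally show "\<theta> (d (x \<otimes>\<^bsub>T\<^esub> y)) \<ominus>\<^bsub>T\<^esub> \<theta> (d (\<theta> (x \<otimes>\<^bsub>T\<^esub> y)))
      = (\<theta> (d x) \<ominus>\<^bsub>T\<^esub> \<theta> (d (\<theta> x))) \<otimes>\<^bsub>T\<^esub> y \<oplus>\<^bsub>T\<^esub> x \<otimes>\<^bsub>T\<^esub> (\<theta> (d y) \<ominus>\<^bsub>T\<^esub> \<theta> (d (\<theta> y)))"
    by (simp add: p_def q_def)
qed

text \<open>
  For \<open>d\<close> additive, \<open>\<theta> d = \<theta> d \<theta>\<close> says that \<open>d\<close> maps the kernel of \<open>\<theta>\<close>, which is that of \<open>\<pi>\<close>, to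
  itself.
\<close>

definition kernel_preserving :: "('t \<Rightarrow> 't) set"
  where "kernel_preserving = {d \<in> derivations K T. \<forall>x\<in>carrier T. \<theta> (d (\<theta> x)) = \<theta> (d x)}"

text \<open>
  \<open>d \<theta> = \<theta> d \<theta>\<close> says that \<open>d\<close> maps the image of \<open>\<theta>\<close>, which is that of \<open>\<iota>\<close>, to itself.
\<close>

definition section_preserving :: "('t \<Rightarrow> 't) set"
  where "section_preserving = {d \<in> derivations K T. \<forall>x\<in>carrier T. \<theta> (d (\<theta> x)) = d (\<theta> x)}"

lemma kernel_preservingD:
  assumes "d \<in> kernel_preserving"
  shows "d \<in> derivations K T" and "x \<in> carrier T \<Longrightarrow> \<theta> (d (\<theta> x)) = \<theta> (d x)"
  using assms by (auto simp: kernel_preserving_def)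

lemma section_preservingD:
  assumes "d \<in> section_preserving"
  shows "d \<in> derivations K T" and "x \<in> carrier T \<Longrightarrow> \<theta> (d (\<theta> x)) = d (\<theta> x)"
  using assms by (auto simp: section_preserving_def)

lemma lie_subalgebraI:
  assumes "D \<subseteq> derivations K T" "\<zero>\<^bsub>Der K T\<^esub> \<in> D"
    and "\<And>d. d \<in> D \<Longrightarrow> \<ominus>\<^bsub>Der K T\<^esub> d \<in> D"
    and "\<And>d e. \<lbrakk>d \<in> D; e \<in> D\<rbrakk> \<Longrightarrow> d \<oplus>\<^bsub>Der K T\<^esub> e \<in> D"
    and "\<And>k d. \<lbrakk>k \<in> carrier K; d \<in> D\<rbrakk> \<Longrightarrow> k \<odot>\<^bsub>Der K T\<^esub> d \<in> D"
    and "\<And>d e. \<lbrakk>d \<in> D; e \<in> D\<rbrakk> \<Longrightarrow> bracket (Der K T) d e \<in> D"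
  shows "lie_subalgebra D K (Der K T)"
  using assms
  by (intro lie_subalgebra.intro lie_subalgebra_axioms.intro T.lie_algebra_Der T.Der.submoduleI)
    (auto simp: T.Der_simps)

lemma lie_subalgebra_kernel_preserving: "lie_subalgebra kernel_preserving K (Der K T)"
proof (rule lie_subalgebraI)
  show "kernel_preserving \<subseteq> derivations K T" by (auto simp: kernel_preserving_def)
  show "\<zero>\<^bsub>Der K T\<^esub> \<in> kernel_preserving"
    by (simp add: kernel_preserving_def T.Der_closed T.Der_simps \<theta>_simps)
next
  fix d assume d: "d \<in> kernel_preserving"
  note d' = kernel_preservingD[OF d] note s = T.derivation_simps[OF d'(1)]
  show "\<ominus>\<^bsub>Der K T\<^esub> d \<in> kernel_preserving"
    by (simp add: kernel_preserving_def T.Der_minus_closed T.Der_a_inv d' s \<theta>_simps)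
  {
    fix k assume "k \<in> carrier K"
    then show "k \<odot>\<^bsub>Der K T\<^esub> d \<in> kernel_preserving"
      by (simp add: kernel_preserving_def T.Der_closed T.Der_simps d' s \<theta>_simps)
  }
  fix e assume e: "e \<in> kernel_preserving"
  note e' = kernel_preservingD[OF e] note s = s T.derivation_simps[OF e'(1)]
  show "d \<oplus>\<^bsub>Der K T\<^esub> e \<in> kernel_preserving"
    by (simp add: kernel_preserving_def T.Der_closed T.Der_simps d' e' s \<theta>_simps)
  have "\<theta> (d (e (\<theta> x))) = \<theta> (d (e x))" "\<theta> (e (d (\<theta> x))) = \<theta> (e (d x))" if "x \<in> carrier T" for x
    using that d'(2)[of "e (\<theta> x)"] d'(2)[of "e x"] e'(2)[of "d (\<theta> x)"] e'(2)[of "d x"]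
    by (simp_all add: d'(2) e'(2) s \<theta>_simps)
  then show "bracket (Der K T) d e \<in> kernel_preserving"
    by (simp add: kernel_preserving_def T.Der_closed T.Der_simps d'(1) e'(1) s \<theta>_simps)
qed

lemma lie_subalgebra_section_preserving: "lie_subalgebra section_preserving K (Der K T)"
proof (rule lie_subalgebraI)
  show "section_preserving \<subseteq> derivations K T" by (auto simp: section_preserving_def)
  show "\<zero>\<^bsub>Der K T\<^esub> \<in> section_preserving"
    by (simp add: section_preserving_def T.Der_closed T.Der_simps \<theta>_simps)
next
  fix d assume d: "d \<in> section_preserving"
  note d' = section_preservingD[OF d] note s = T.derivation_simps[OF d'(1)]
  show "\<ominus>\<^bsub>Der K T\<^esub> d \<in> section_preserving"
    by (simp add: section_preserving_def T.Der_minus_closed T.Der_a_inv d' s \<theta>_simps)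
  {
    fix k assume "k \<in> carrier K"
    then show "k \<odot>\<^bsub>Der K T\<^esub> d \<in> section_preserving"
      by (simp add: section_preserving_def T.Der_closed T.Der_simps d' s \<theta>_simps)
  }
  fix e assume e: "e \<in> section_preserving"
  note e' = section_preservingD[OF e] note s = s T.derivation_simps[OF e'(1)]
  show "d \<oplus>\<^bsub>Der K T\<^esub> e \<in> section_preserving"
    by (simp add: section_preserving_def T.Der_closed T.Der_simps d' e' s \<theta>_simps)
  have "\<theta> (d (e (\<theta> x))) = d (e (\<theta> x))" "\<theta> (e (d (\<theta> x))) = e (d (\<theta> x))" if "x \<in> carrier T" for x
    using that d'(2)[of "e (\<theta> x)"] e'(2)[of "d (\<theta> x)"]
    by (simp_all add: d'(2) e'(2) s \<theta>_simps)
  then show "bracket (Der K T) d e \<in> section_preserving"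
    by (simp add: section_preserving_def T.Der_closed T.Der_simps d'(1) e'(1) s \<theta>_simps)
qed

lemma lie_subalgebra_inter:
  "lie_subalgebra (kernel_preserving \<inter> section_preserving) K (Der K T)"
proof -
  interpret kp: lie_subalgebra kernel_preserving K "Der K T"
    by (rule lie_subalgebra_kernel_preserving)
  interpret sp: lie_subalgebra section_preserving K "Der K T"
    by (rule lie_subalgebra_section_preserving)
  note kpE = T.Der.submoduleE[OF kp.submodule_axioms]
  note spE = T.Der.submoduleE[OF sp.submodule_axioms]
  show ?thesis
    using kpE spE kp.one_closed sp.one_closed kp.bracket_mem sp.bracket_mem
    by (intro lie_subalgebraI) (auto simp: kernel_preserving_def)
qed

text \<open>
  The kernel is a two-sided ideal.
\<close>

lemma ad_kernel_preserving:
  assumes "t \<in> carrier T" shows "T.ad t \<in> kernel_preserving"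
  using assms by (simp add: kernel_preserving_def T.ad_derivation T.ad_apply \<theta>_simps)

lemma ad_section_preserving:
  assumes "t \<in> carrier T" "\<theta> t = t" shows "T.ad t \<in> section_preserving"
  using assms by (simp add: section_preserving_def T.ad_derivation T.ad_apply \<theta>_simps)

lemma to_kernel_kernel_preserving:
  assumes d: "d \<in> derivations K T" shows "to_kernel d \<in> kernel_preserving"
  using to_kernel_derivation[OF d]
  by (simp add: kernel_preserving_def to_kernel_def \<theta>_simps T.derivation_simps[OF d]
      T.M.minus_eq T.M.r_neg)

text \<open>
  Removing the block \<open>\<iota>(S) \<rightarrow> J\<close> leaves a block triangular derivation; with the previous lemma, every
  derivation is a sum of block triangular ones of the two kinds.
\<close>

lemma minus_to_kernel_section_preserving:
  assumes d: "d \<in> derivations K T" shows "d \<ominus>\<^bsub>Der K T\<^esub> to_kernel d \<in> section_preserving"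
proof -
  note s = T.derivation_simps[OF d]
  note t = to_kernel_derivation[OF d]
  have "(d \<ominus>\<^bsub>Der K T\<^esub> to_kernel d) (\<theta> x) = \<theta> (d (\<theta> x))" if x: "x \<in> carrier T" for x
  proof -
    have c: "d (\<theta> x) \<in> carrier T" "\<theta> (d (\<theta> x)) \<in> carrier T" using x by (simp_all add: s \<theta>_simps)
    have "(d \<ominus>\<^bsub>Der K T\<^esub> to_kernel d) (\<theta> x) = d (\<theta> x) \<ominus>\<^bsub>T\<^esub> (d (\<theta> x) \<ominus>\<^bsub>T\<^esub> \<theta> (d (\<theta> x)))"
      using x by (simp add: T.Der_minus d t \<theta>_simps) (simp add: to_kernel_def \<theta>_simps)
    also have "\<dots> = \<theta> (d (\<theta> x))" using c by algebra
    finally show ?thesis .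
  qed
  then show ?thesis
    by (simp add: section_preserving_def T.Der_minus_closed d t \<theta>_simps s)
qed

definition diagonal :: "('t \<Rightarrow> 't) \<Rightarrow> 't \<Rightarrow> 't"
  where "diagonal d = d \<ominus>\<^bsub>Der K T\<^esub> to_kernel d \<ominus>\<^bsub>Der K T\<^esub> from_kernel d"

lemma diagonal_apply:
  assumes d: "d \<in> derivations K T" and x: "x \<in> carrier T"
  shows "diagonal d x = d x \<ominus>\<^bsub>T\<^esub> (d (\<theta> x) \<ominus>\<^bsub>T\<^esub> \<theta> (d (\<theta> x))) \<ominus>\<^bsub>T\<^esub> (\<theta> (d x) \<ominus>\<^bsub>T\<^esub> \<theta> (d (\<theta> x)))"
  using x d by (simp add: diagonal_def T.Der_minus T.Der_minus_closed to_kernel_derivation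
      from_kernel_derivation) (simp add: to_kernel_def from_kernel_def)

lemma diagonal_derivation: "d \<in> derivations K T \<Longrightarrow> diagonal d \<in> derivations K T"
  by (simp add: diagonal_def T.Der_minus_closed to_kernel_derivation from_kernel_derivation)

lemma diagonal_preserving:
  assumes d: "d \<in> derivations K T"
  shows "diagonal d \<in> kernel_preserving \<inter> section_preserving"
proof -
  note s = T.derivation_simps[OF d]
  have "diagonal d (\<theta> x) = \<theta> (d (\<theta> x))" "\<theta> (diagonal d x) = \<theta> (d (\<theta> x))" if x: "x \<in> carrier T" for x
  proof -
    have c: "d (\<theta> x) \<in> carrier T" "\<theta> (d (\<theta> x)) \<in> carrier T" "\<theta> (d x) \<in> carrier T" "d x \<in> carrier T"
      using x by (simp_all add: s \<theta>_simps)
    show "diagonal d (\<theta> x) = \<theta> (d (\<theta> x))"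
      using x by (simp add: diagonal_apply[OF d] s \<theta>_simps, insert c, algebra)
    show "\<theta> (diagonal d x) = \<theta> (d (\<theta> x))"
      using x by (simp add: diagonal_apply[OF d] s \<theta>_simps, insert c, algebra)
  qed
  then show ?thesis
    using d by (simp add: kernel_preserving_def section_preserving_def diagonal_derivation \<theta>_simps s)
qed

text \<open>
  The upper left block of \<open>d\<close>, read as a map \<open>S \<rightarrow> S\<close>.
\<close>

definition restr :: "('t \<Rightarrow> 't) \<Rightarrow> 's \<Rightarrow> 's"
  where "restr d = (\<lambda>s\<in>carrier S. \<pi> (d (\<iota> s)))"

lemma restr_apply: "s \<in> carrier S \<Longrightarrow> restr d s = \<pi> (d (\<iota> s))"
  by (simp add: restr_def)

lemma restr_derivation:
  assumes d: "d \<in> derivations K T" shows "restr d \<in> derivations K S"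
  unfolding restr_def
  by (rule S.derivationI) (simp_all add: T.derivation_simps[OF d] proj_simps incl_simps)

lemma restr_add:
  assumes d: "d \<in> derivations K T" and e: "e \<in> derivations K T"
  shows "restr (d \<oplus>\<^bsub>Der K T\<^esub> e) = restr d \<oplus>\<^bsub>Der K S\<^esub> restr e"
  by (rule S.derivation_eqI)
    (simp_all add: restr_derivation T.Der_closed S.Der_closed d e restr_apply T.Der_simps S.Der_simps
      T.derivation_simps[OF d] T.derivation_simps[OF e] proj_simps incl_simps)

lemma restr_smult:
  assumes k: "k \<in> carrier K" and d: "d \<in> derivations K T"
  shows "restr (k \<odot>\<^bsub>Der K T\<^esub> d) = k \<odot>\<^bsub>Der K S\<^esub> restr d"
  by (rule S.derivation_eqI)
    (simp_all add: restr_derivation T.Der_closed S.Der_closed d k restr_apply T.Der_simps S.Der_simps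
      T.derivation_simps[OF d] proj_simps incl_simps)

lemma restr_minus:
  assumes d: "d \<in> derivations K T" and e: "e \<in> derivations K T"
  shows "restr (d \<ominus>\<^bsub>Der K T\<^esub> e) = restr d \<ominus>\<^bsub>Der K S\<^esub> restr e"
  by (rule S.derivation_eqI)
    (simp_all add: restr_derivation T.Der_minus_closed S.Der_minus_closed d e restr_apply
      T.Der_minus S.Der_minus
      T.derivation_simps[OF d] T.derivation_simps[OF e] proj_simps incl_simps)

lemma restr_ad:
  assumes t: "t \<in> carrier T" shows "restr (T.ad t) = S.ad (\<pi> t)"
  by (rule S.derivation_eqI)
    (simp_all add: restr_derivation T.ad_derivation S.ad_derivation t restr_apply T.ad_apply
      S.ad_apply proj_simps incl_simps)

text \<open>
  The upper left block of \<open>d \<circ> e\<close> is the product of those of \<open>d\<close> and \<open>e\<close> as soon as the path through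
  the kernel, \<open>\<pi> d (1 - \<theta>) e \<iota>\<close>, contributes nothing.
\<close>

lemma restr_bracket:
  assumes d: "d \<in> derivations K T" and e: "e \<in> derivations K T"
    and de: "\<And>x. x \<in> carrier T \<Longrightarrow> \<pi> (d (e (\<theta> x))) = \<pi> (d (\<theta> (e (\<theta> x))))"
    and ed: "\<And>x. x \<in> carrier T \<Longrightarrow> \<pi> (e (d (\<theta> x))) = \<pi> (e (\<theta> (d (\<theta> x))))"
  shows "restr (bracket (Der K T) d e) = bracket (Der K S) (restr d) (restr e)"
proof (rule S.derivation_eqI)
  note s = T.derivation_simps[OF d] T.derivation_simps[OF e] proj_simps incl_simps
  fix x assume x: "x \<in> carrier S"
  show "restr (bracket (Der K T) d e) x = bracket (Der K S) (restr d) (restr e) x"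
    using x de[of "\<iota> x"] ed[of "\<iota> x"]
    by (simp add: s restr_apply T.Der_simps S.Der_simps \<theta>_def)
qed (simp_all add: d e restr_derivation T.Der_closed S.Der_closed)

lemma restr_bracket_kernel_preserving:
  assumes "d \<in> kernel_preserving" "e \<in> kernel_preserving"
  shows "restr (bracket (Der K T) d e) = bracket (Der K S) (restr d) (restr e)"
proof -
  note d = kernel_preservingD[OF assms(1)] and e = kernel_preservingD[OF assms(2)]
  note s = T.derivation_simps[OF d(1)] T.derivation_simps[OF e(1)]
  have \<pi>d: "\<pi> (d (\<theta> y)) = \<pi> (d y)" if y: "y \<in> carrier T" for y
    using arg_cong[OF d(2)[OF y], of \<pi>] y by (simp add: proj_\<theta> s \<theta>_simps)
  have \<pi>e: "\<pi> (e (\<theta> y)) = \<pi> (e y)" if y: "y \<in> carrier T" for y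
    using arg_cong[OF e(2)[OF y], of \<pi>] y by (simp add: proj_\<theta> s \<theta>_simps)
  show ?thesis
    by (rule restr_bracket[OF d(1) e(1)]) (simp_all add: \<pi>d \<pi>e s \<theta>_simps)
qed

lemma restr_bracket_section_preserving:
  assumes "d \<in> section_preserving" "e \<in> section_preserving"
  shows "restr (bracket (Der K T) d e) = bracket (Der K S) (restr d) (restr e)"
  using section_preservingD[OF assms(1)] section_preservingD[OF assms(2)]
  by (intro restr_bracket) simp_all

text \<open>
  The off-diagonal blocks have zero upper left block.
\<close>

lemma restr_diagonal:
  assumes d: "d \<in> derivations K T" shows "restr (diagonal d) = restr d"
proof (rule S.derivation_eqI)
  note s = T.derivation_simps[OF d]
  fix x assume x: "x \<in> carrier S"
  have c: "\<pi> (d (\<iota> x)) \<in> carrier S" using x by (simp add: s incl_simps proj_simps)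
  show "restr (diagonal d) x = restr d x"
    using x
    by (simp add: restr_apply diagonal_apply[OF d] s proj_simps incl_simps \<theta>_simps \<theta>_incl proj_\<theta>,
        insert c, algebra)
qed (simp_all add: d restr_derivation diagonal_derivation)

abbreviation cls :: "('t \<Rightarrow> 't) \<Rightarrow> ('t \<Rightarrow> 't) set"
  where "cls \<equiv> HH1_class K T"

lemma restr_class_cong:
  assumes d: "d \<in> derivations K T" and e: "e \<in> derivations K T" and eq: "cls d = cls e"
  shows "HH1_class K S (restr d) = HH1_class K S (restr e)"
proof -
  from eq obtain t where t: "t \<in> carrier T" "d \<ominus>\<^bsub>Der K T\<^esub> e = T.ad t"
    by (auto simp: T.HH1_class_eq_iff d e T.Int_der_eq)
  then have "restr d \<ominus>\<^bsub>Der K S\<^esub> restr e = S.ad (\<pi> t)"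
    by (simp add: restr_minus[OF d e, symmetric] restr_ad)
  then show ?thesis
    using t by (simp add: S.HH1_class_eq_iff restr_derivation d e S.Int_der_eq proj_closed)
qed

text \<open>
  If \<open>d\<close> preserves the kernel, \<open>e\<close> preserves the section and \<open>d - e\<close> is inner, then \<open>e\<close> also preserves
  the kernel, because inner derivations do.
\<close>

lemma classes_inter:
  "cls ` kernel_preserving \<inter> cls ` section_preserving
    = cls ` (kernel_preserving \<inter> section_preserving)"
proof
  show "cls ` kernel_preserving \<inter> cls ` section_preserving
      \<subseteq> cls ` (kernel_preserving \<inter> section_preserving)"
  proof clarify
    fix d e assume d: "d \<in> kernel_preserving" and e: "e \<in> section_preserving"
      and eq: "cls d = cls e"
    interpret kp: lie_subalgebra kernel_preserving K "Der K T"
      by (rule lie_subalgebra_kernel_preserving)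
    note kpE = T.Der.submoduleE[OF kp.submodule_axioms]
    note de = kernel_preservingD(1)[OF d] section_preservingD(1)[OF e]
    from eq obtain t where t: "t \<in> carrier T" "d \<ominus>\<^bsub>Der K T\<^esub> e = T.ad t"
      by (auto simp: T.HH1_class_eq_iff de T.Int_der_eq)
    have "e = d \<oplus>\<^bsub>Der K T\<^esub> \<ominus>\<^bsub>Der K T\<^esub> (d \<ominus>\<^bsub>Der K T\<^esub> e)"
      using de T.Der.M.a_inv_closed[unfolded T.Der_simps(1)]
      by (simp add: T.Der_simps T.Der.M.minus_eq T.Der.M.minus_add T.Der.M.minus_minus
          T.Der.M.r_neg2)
    also have "\<dots> \<in> kernel_preserving"
      unfolding t(2) using d t(1) by (intro kpE(3,5) ad_kernel_preserving)
    finally show "cls d \<in> cls ` (kernel_preserving \<inter> section_preserving)"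
      using e eq by auto
  qed
qed auto

lemma classes_sum:
  "cls ` kernel_preserving <+>\<^bsub>HH1 K T\<^esub> cls ` section_preserving = carrier (HH1 K T)"
proof
  show "cls ` kernel_preserving <+>\<^bsub>HH1 K T\<^esub> cls ` section_preserving \<subseteq> carrier (HH1 K T)"
    by (auto simp: set_add_def' T.carrier_HH1 T.HH1_class_simps(1) T.Der_closed
        dest!: kernel_preservingD(1) section_preservingD(1))
  show "carrier (HH1 K T) \<subseteq> cls ` kernel_preserving <+>\<^bsub>HH1 K T\<^esub> cls ` section_preserving"
  proof
    fix X assume "X \<in> carrier (HH1 K T)"
    then obtain d where d: "d \<in> derivations K T" "X = cls d" by (auto simp: T.carrier_HH1)
    let ?u = "to_kernel d" and ?v = "d \<ominus>\<^bsub>Der K T\<^esub> to_kernel d"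
    have u: "?u \<in> kernel_preserving" "?u \<in> derivations K T"
      using d by (simp_all add: to_kernel_kernel_preserving to_kernel_derivation)
    have v: "?v \<in> section_preserving" "?v \<in> derivations K T"
      using d u by (simp_all add: minus_to_kernel_section_preserving T.Der_minus_closed)
    have "d = ?u \<oplus>\<^bsub>Der K T\<^esub> ?v"
      using d u T.Der.M.a_inv_closed[unfolded T.Der_simps(1)]
      by (simp add: T.Der_simps T.Der.M.minus_eq T.Der.M.a_comm[of d] T.Der.M.r_neg2)
    then have "X = cls ?u \<oplus>\<^bsub>HH1 K T\<^esub> cls ?v" using d u v by (simp add: T.HH1_class_simps(1))
    then show "X \<in> cls ` kernel_preserving <+>\<^bsub>HH1 K T\<^esub> cls ` section_preserving"
      using u v by (auto simp: set_add_def')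
  qed
qed

end

text \<open>
  Only the values on classes of derivations matter; in the application \<open>r\<close> is defined by
  particular representatives.
\<close>

locale induced_restriction = split_square_zero K T S \<pi> \<iota>
  for K :: "'k ring" and T :: "('k, 't) module" and S :: "('k, 's) module"
    and \<pi> :: "'t \<Rightarrow> 's" and \<iota> :: "'s \<Rightarrow> 't" +
  fixes r :: "('t \<Rightarrow> 't) set \<Rightarrow> ('s \<Rightarrow> 's) set"
  assumes r_cls: "d \<in> derivations K T \<Longrightarrow> r (cls d) = HH1_class K S (restr d)"
begin

lemma lie_hom_classes:
  assumes D: "lie_subalgebra D K (Der K T)"
    and bracket: "\<And>d e. \<lbrakk>d \<in> D; e \<in> D\<rbrakk>
      \<Longrightarrow> restr (bracket (Der K T) d e) = bracket (Der K S) (restr d) (restr e)"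
  shows "r \<in> lie_hom K (HH1 K T\<lparr>carrier := cls ` D\<rparr>) (HH1 K S)"
proof -
  interpret D: lie_subalgebra D K "Der K T" by fact
  have sub: "d \<in> derivations K T" if "d \<in> D" for d
    using D.subset that by (auto simp: T.Der_simps)
  show ?thesis
    unfolding lie_hom_def
    by (auto simp: sub r_cls restr_derivation T.HH1_class_simps S.HH1_class_simps T.Der_closed
        S.carrier_HH1 restr_add restr_smult bracket)
qed

text \<open>
  The class of \<open>d\<close> and that of its diagonal part have the same restriction.
\<close>

lemma image_eq:
  assumes "kernel_preserving \<inter> section_preserving \<subseteq> D" "D \<subseteq> derivations K T"
  shows "r ` cls ` D = r ` carrier (HH1 K T)"
proof
  show "r ` cls ` D \<subseteq> r ` carrier (HH1 K T)" using assms by (auto simp: T.carrier_HH1)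
  show "r ` carrier (HH1 K T) \<subseteq> r ` cls ` D"
  proof
    fix Y assume "Y \<in> r ` carrier (HH1 K T)"
    then obtain d where d: "d \<in> derivations K T" "Y = r (cls d)" by (auto simp: T.carrier_HH1)
    then have "Y = r (cls (diagonal d))" by (simp add: r_cls diagonal_derivation restr_diagonal)
    moreover have "diagonal d \<in> D" using diagonal_preserving[OF d(1)] assms by auto
    ultimately show "Y \<in> r ` cls ` D" by blast
  qed
qed

theorem decomposition:
  defines "H\<^sub>1 \<equiv> cls ` kernel_preserving" and "H\<^sub>2 \<equiv> cls ` section_preserving"
    and "H\<^sub>0 \<equiv> cls ` (kernel_preserving \<inter> section_preserving)"
  shows "lie_subalgebra H\<^sub>1 K (HH1 K T) \<and> lie_subalgebra H\<^sub>2 K (HH1 K T) \<and>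
    H\<^sub>1 <+>\<^bsub>HH1 K T\<^esub> H\<^sub>2 = carrier (HH1 K T) \<and> H\<^sub>1 \<inter> H\<^sub>2 = H\<^sub>0 \<and>
    r \<in> lie_hom K (HH1 K T\<lparr>carrier := H\<^sub>1\<rparr>) (HH1 K S) \<and>
    r \<in> lie_hom K (HH1 K T\<lparr>carrier := H\<^sub>2\<rparr>) (HH1 K S) \<and>
    r \<in> lie_hom K (HH1 K T\<lparr>carrier := H\<^sub>0\<rparr>) (HH1 K S) \<and>
    r ` H\<^sub>1 = r ` carrier (HH1 K T) \<and> r ` H\<^sub>2 = r ` carrier (HH1 K T) \<and>
    r ` H\<^sub>0 = r ` carrier (HH1 K T)"
  unfolding H\<^sub>1_def H\<^sub>2_def H\<^sub>0_def
  by (intro conjI T.lie_subalgebra_classes classes_sum classes_inter lie_hom_classes image_eq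
      lie_subalgebra_kernel_preserving lie_subalgebra_section_preserving lie_subalgebra_inter)
    (auto simp: restr_bracket_kernel_preserving restr_bracket_section_preserving
      dest: kernel_preservingD(1) section_preservingD(1))

end


section \<open>Triangular matrix algebras and the normal form of their derivations\<close>

lemma tri_algebra_simps:
  "carrier (tri_algebra A M B) = carrier A \<times> carrier M \<times> carrier B"
  "(a, m, b) \<otimes>\<^bsub>tri_algebra A M B\<^esub> (a', m', b')
    = (a \<otimes>\<^bsub>A\<^esub> a', lact M a m' \<oplus>\<^bsub>M\<^esub> ract M m b', b \<otimes>\<^bsub>B\<^esub> b')"
  "\<one>\<^bsub>tri_algebra A M B\<^esub> = (\<one>\<^bsub>A\<^esub>, \<zero>\<^bsub>M\<^esub>, \<one>\<^bsub>B\<^esub>)"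
  "\<zero>\<^bsub>tri_algebra A M B\<^esub> = (\<zero>\<^bsub>A\<^esub>, \<zero>\<^bsub>M\<^esub>, \<zero>\<^bsub>B\<^esub>)"
  "(a, m, b) \<oplus>\<^bsub>tri_algebra A M B\<^esub> (a', m', b') = (a \<oplus>\<^bsub>A\<^esub> a', m \<oplus>\<^bsub>M\<^esub> m', b \<oplus>\<^bsub>B\<^esub> b')"
  "k \<odot>\<^bsub>tri_algebra A M B\<^esub> (a, m, b) = (k \<odot>\<^bsub>A\<^esub> a, k \<odot>\<^bsub>M\<^esub> m, k \<odot>\<^bsub>B\<^esub> b)"
  by (simp_all add: tri_algebra_def)

lemma bimod_sum_simps:
  "carrier (bimod_sum M N) = carrier M \<times> carrier N"
  "\<zero>\<^bsub>bimod_sum M N\<^esub> = (\<zero>\<^bsub>M\<^esub>, \<zero>\<^bsub>N\<^esub>)"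
  "(m, n) \<oplus>\<^bsub>bimod_sum M N\<^esub> (m', n') = (m \<oplus>\<^bsub>M\<^esub> m', n \<oplus>\<^bsub>N\<^esub> n')"
  "k \<odot>\<^bsub>bimod_sum M N\<^esub> (m, n) = (k \<odot>\<^bsub>M\<^esub> m, k \<odot>\<^bsub>N\<^esub> n)"
  "lact (bimod_sum M N) a (m, n) = (lact M a m, lact N a n)"
  "ract (bimod_sum M N) (m, n) b = (ract M m b, ract N n b)"
  by (simp_all add: bimod_sum_def)

context bimodule
begin

lemma lact_zero_left: "m \<in> carrier M \<Longrightarrow> lact M \<zero>\<^bsub>A\<^esub> m = \<zero>\<^bsub>M\<^esub>"
  using lact_add_left[of "\<zero>\<^bsub>A\<^esub>" "\<zero>\<^bsub>A\<^esub>" m] lact_closed[of "\<zero>\<^bsub>A\<^esub>" m] by simp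

lemma lact_zero_right: "a \<in> carrier A \<Longrightarrow> lact M a \<zero>\<^bsub>M\<^esub> = \<zero>\<^bsub>M\<^esub>"
  using lact_add_right[of a "\<zero>\<^bsub>M\<^esub>" "\<zero>\<^bsub>M\<^esub>"] lact_closed[of a "\<zero>\<^bsub>M\<^esub>"] by simp

lemma ract_zero_left: "b \<in> carrier B \<Longrightarrow> ract M \<zero>\<^bsub>M\<^esub> b = \<zero>\<^bsub>M\<^esub>"
  using ract_add_left[of "\<zero>\<^bsub>M\<^esub>" "\<zero>\<^bsub>M\<^esub>" b] ract_closed[of "\<zero>\<^bsub>M\<^esub>" b] by simp

lemma ract_zero_right: "m \<in> carrier M \<Longrightarrow> ract M m \<zero>\<^bsub>B\<^esub> = \<zero>\<^bsub>M\<^esub>"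
  using ract_add_right[of m "\<zero>\<^bsub>B\<^esub>" "\<zero>\<^bsub>B\<^esub>"] ract_closed[of m "\<zero>\<^bsub>B\<^esub>"] by simp

lemmas act_simps = lact_closed lact_zero_left lact_zero_right lact_one
  ract_closed ract_zero_left ract_zero_right ract_one

lemmas act_distribs = lact_add_left lact_add_right ract_add_left ract_add_right
  lact_mult ract_mult lact_ract
  lact_smult_left lact_smult_right ract_smult_left ract_smult_right

lemma abelian_group_tri_algebra: "abelian_group (tri_algebra A M B)"
proof (rule abelian_groupI)
  fix x assume "x \<in> carrier (tri_algebra A M B)"
  then obtain a m b where x: "x = (a, m, b)" "a \<in> carrier A" "m \<in> carrier M" "b \<in> carrier B"
    by (auto simp: tri_algebra_simps)
  then show "\<exists>y\<in>carrier (tri_algebra A M B). y \<oplus>\<^bsub>tri_algebra A M B\<^esub> x = \<zero>\<^bsub>tri_algebra A M B\<^esub>"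
    by (intro bexI[of _ "(\<ominus>\<^bsub>A\<^esub> a, \<ominus>\<^bsub>M\<^esub> m, \<ominus>\<^bsub>B\<^esub> b)"])
      (auto simp: tri_algebra_simps A.M.l_neg B.M.l_neg M.M.l_neg)
qed (auto simp: tri_algebra_simps A.M.a_assoc B.M.a_assoc M.M.a_assoc
    intro: A.M.a_comm B.M.a_comm M.M.a_comm)

lemma unital_algebra_tri_algebra: "unital_algebra K (tri_algebra A M B)"
proof (intro unital_algebra.intro unital_algebra_axioms.intro)
  show "module K (tri_algebra A M B)"
    by (rule moduleI[OF A.R.is_cring abelian_group_tri_algebra])
      (auto simp: tri_algebra_simps A.smult_l_distr B.smult_l_distr M.smult_l_distr
        A.smult_r_distr B.smult_r_distr M.smult_r_distr
        A.smult_assoc1 B.smult_assoc1 M.smult_assoc1)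
  show "ring (tri_algebra A M B)"
  proof (rule ringI[OF abelian_group_tri_algebra])
    show "monoid (tri_algebra A M B)"
      by (rule monoidI)
        (auto simp: tri_algebra_simps act_simps act_distribs A.A.m_assoc B.A.m_assoc M.M.a_assoc)
  qed (auto simp: tri_algebra_simps act_simps act_distribs A.A.l_distr B.A.l_distr A.A.r_distr
      B.A.r_distr M.M.a_ac)
qed (auto simp: tri_algebra_simps act_simps act_distribs A.smult_mult_left A.smult_mult_right
    B.smult_mult_left B.smult_mult_right M.smult_r_distr)

sublocale tri: unital_algebra K "tri_algebra A M B"
  by (rule unital_algebra_tri_algebra)

lemma tri_dataD:
  assumes "(\<alpha>, \<mu>, \<beta>) \<in> tri_data K A M B"
  shows "\<alpha> \<in> derivations K A" and "\<beta> \<in> derivations K B"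
    and "m \<in> carrier M \<Longrightarrow> \<mu> m \<in> carrier M"
    and "\<lbrakk>m \<in> carrier M; m' \<in> carrier M\<rbrakk> \<Longrightarrow> \<mu> (m \<oplus>\<^bsub>M\<^esub> m') = \<mu> m \<oplus>\<^bsub>M\<^esub> \<mu> m'"
    and "\<lbrakk>k \<in> carrier K; m \<in> carrier M\<rbrakk> \<Longrightarrow> \<mu> (k \<odot>\<^bsub>M\<^esub> m) = k \<odot>\<^bsub>M\<^esub> \<mu> m"
    and "\<lbrakk>a \<in> carrier A; m \<in> carrier M\<rbrakk>
      \<Longrightarrow> \<mu> (lact M a m) = lact M (\<alpha> a) m \<oplus>\<^bsub>M\<^esub> lact M a (\<mu> m)"
    and "\<lbrakk>m \<in> carrier M; b \<in> carrier B\<rbrakk>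
      \<Longrightarrow> \<mu> (ract M m b) = ract M (\<mu> m) b \<oplus>\<^bsub>M\<^esub> ract M m (\<beta> b)"
  using assms by (auto simp: tri_data_def lin_End_def PiE_def Pi_def)

lemma tri_der_apply:
  "\<lbrakk>a \<in> carrier A; m \<in> carrier M; b \<in> carrier B\<rbrakk>
    \<Longrightarrow> tri_der A M B \<alpha> \<mu> \<beta> (a, m, b) = (\<alpha> a, \<mu> m, \<beta> b)"
  by (simp add: tri_der_def tri_algebra_simps)

lemma tri_der_derivation:
  assumes data: "(\<alpha>, \<mu>, \<beta>) \<in> tri_data K A M B"
  shows "tri_der A M B \<alpha> \<mu> \<beta> \<in> derivations K (tri_algebra A M B)"
proof -
  note D = tri_dataD[OF data]
  note s = A.derivation_simps[OF D(1)] B.derivation_simps[OF D(2)] D(3-7)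
  show ?thesis
    unfolding tri_der_def
    by (rule tri.derivationI)
      (auto simp: tri_algebra_simps s act_simps act_distribs M.M.a_ac)
qed

definition e\<^sub>1 :: "'a \<times> 'm \<times> 'b" where "e\<^sub>1 = (\<one>\<^bsub>A\<^esub>, \<zero>\<^bsub>M\<^esub>, \<zero>\<^bsub>B\<^esub>)"

definition e\<^sub>2 :: "'a \<times> 'm \<times> 'b" where "e\<^sub>2 = (\<zero>\<^bsub>A\<^esub>, \<zero>\<^bsub>M\<^esub>, \<one>\<^bsub>B\<^esub>)"

lemma e_closed: "e\<^sub>1 \<in> carrier (tri_algebra A M B)" "e\<^sub>2 \<in> carrier (tri_algebra A M B)"
  by (simp_all add: e\<^sub>1_def e\<^sub>2_def tri_algebra_simps)

lemma e_mult:
  assumes "a \<in> carrier A" "m \<in> carrier M" "b \<in> carrier B"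
  shows "e\<^sub>1 \<otimes>\<^bsub>tri_algebra A M B\<^esub> (a, m, b) = (a, m, \<zero>\<^bsub>B\<^esub>)"
    and "(a, m, b) \<otimes>\<^bsub>tri_algebra A M B\<^esub> e\<^sub>1 = (a, \<zero>\<^bsub>M\<^esub>, \<zero>\<^bsub>B\<^esub>)"
    and "e\<^sub>2 \<otimes>\<^bsub>tri_algebra A M B\<^esub> (a, m, b) = (\<zero>\<^bsub>A\<^esub>, \<zero>\<^bsub>M\<^esub>, b)"
    and "(a, m, b) \<otimes>\<^bsub>tri_algebra A M B\<^esub> e\<^sub>2 = (\<zero>\<^bsub>A\<^esub>, m, b)"
  using assms by (simp_all add: e\<^sub>1_def e\<^sub>2_def tri_algebra_simps act_simps)

text \<open>
  Apply \<open>d\<close> to \<open>e\<^sub>1 = e\<^sub>1 e\<^sub>1\<close> and compare entries.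
\<close>

lemma derivation_e1_entry:
  assumes d: "d \<in> derivations K (tri_algebra A M B)"
  obtains m where "m \<in> carrier M" "d e\<^sub>1 = (\<zero>\<^bsub>A\<^esub>, m, \<zero>\<^bsub>B\<^esub>)"
proof -
  obtain a m b where x: "d e\<^sub>1 = (a, m, b)" "a \<in> carrier A" "m \<in> carrier M" "b \<in> carrier B"
    using tri.derivation_simps(1)[OF d e_closed(1)] by (auto simp: tri_algebra_simps)
  have "e\<^sub>1 \<otimes>\<^bsub>tri_algebra A M B\<^esub> e\<^sub>1 = e\<^sub>1"
    using e_mult(1)[of "\<one>\<^bsub>A\<^esub>" "\<zero>\<^bsub>M\<^esub>" "\<zero>\<^bsub>B\<^esub>"] by (simp add: e\<^sub>1_def)
  then have "(a, m, b) = (a \<oplus>\<^bsub>A\<^esub> a, m, \<zero>\<^bsub>B\<^esub>)"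
    using tri.derivation_simps(4)[OF d e_closed(1) e_closed(1)] x(2-4)
    by (simp add: x(1) e_mult tri_algebra_simps)
  then have "a = \<zero>\<^bsub>A\<^esub>" "b = \<zero>\<^bsub>B\<^esub>" using x(2) by auto
  with x show ?thesis by (intro that[of m]) auto
qed

text \<open>
  Such a \<open>d\<close> also kills \<open>e\<^sub>2\<close>, so it commutes with multiplication by \<open>e\<^sub>1\<close> and \<open>e\<^sub>2\<close> on either side
  and maps each of the three matrix entries to itself.
\<close>

lemma derivation_killing_e1:
  assumes d: "d \<in> derivations K (tri_algebra A M B)"
    and d_e1: "d e\<^sub>1 = \<zero>\<^bsub>tri_algebra A M B\<^esub>"
  obtains \<alpha> \<mu> \<beta> where "(\<alpha>, \<mu>, \<beta>) \<in> tri_data K A M B" "d = tri_der A M B \<alpha> \<mu> \<beta>"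
proof -
  let ?T = "tri_algebra A M B"
  note s = tri.derivation_simps[OF d]
  obtain a m b where x: "d e\<^sub>2 = (a, m, b)" "a \<in> carrier A" "m \<in> carrier M" "b \<in> carrier B"
    using s(1)[OF e_closed(2)] by (auto simp: tri_algebra_simps)
  have "e\<^sub>1 \<otimes>\<^bsub>?T\<^esub> e\<^sub>2 = \<zero>\<^bsub>?T\<^esub>" "e\<^sub>2 \<otimes>\<^bsub>?T\<^esub> e\<^sub>2 = e\<^sub>2"
    using e_mult(1,3)[of "\<zero>\<^bsub>A\<^esub>" "\<zero>\<^bsub>M\<^esub>" "\<one>\<^bsub>B\<^esub>"] by (simp_all add: e\<^sub>2_def tri_algebra_simps)
  then have "e\<^sub>1 \<otimes>\<^bsub>?T\<^esub> (a, m, b) = \<zero>\<^bsub>?T\<^esub>"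
    and "(a, m, b) \<otimes>\<^bsub>?T\<^esub> e\<^sub>2 \<oplus>\<^bsub>?T\<^esub> e\<^sub>2 \<otimes>\<^bsub>?T\<^esub> (a, m, b) = (a, m, b)"
    using s(1)[OF e_closed(2)] s(4)[OF e_closed] s(4)[OF e_closed(2) e_closed(2)] e_closed
    by (simp_all add: d_e1 s(5) x(1))
  then have "a = \<zero>\<^bsub>A\<^esub>" "m = \<zero>\<^bsub>M\<^esub>" "b \<oplus>\<^bsub>B\<^esub> b = b" "b = \<zero>\<^bsub>B\<^esub>"
    using x(2-4) by (simp_all add: e_mult tri_algebra_simps)
  then have d_e2: "d e\<^sub>2 = \<zero>\<^bsub>?T\<^esub>" by (simp add: x tri_algebra_simps)
  define \<alpha> where "\<alpha> = (\<lambda>a\<in>carrier A. fst (d (a, \<zero>\<^bsub>M\<^esub>, \<zero>\<^bsub>B\<^esub>)))"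
  define \<mu> where "\<mu> = (\<lambda>m\<in>carrier M. fst (snd (d (\<zero>\<^bsub>A\<^esub>, m, \<zero>\<^bsub>B\<^esub>))))"
  define \<beta> where "\<beta> = (\<lambda>b\<in>carrier B. snd (snd (d (\<zero>\<^bsub>A\<^esub>, \<zero>\<^bsub>M\<^esub>, b))))"
  have D: "d (a, m, b) = (\<alpha> a, \<mu> m, \<beta> b)" "\<alpha> a \<in> carrier A" "\<mu> m \<in> carrier M" "\<beta> b \<in> carrier B"
    if abm: "a \<in> carrier A" "m \<in> carrier M" "b \<in> carrier B" for a m b
  proof -
    have x: "(a, m, b) \<in> carrier ?T" using abm by (simp add: tri_algebra_simps)
    obtain a' m' b' where dx: "d (a, m, b) = (a', m', b')"
      and c: "a' \<in> carrier A" "m' \<in> carrier M" "b' \<in> carrier B"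
      using s(1)[OF x] by (auto simp: tri_algebra_simps)
    have c': "(a', m', b') \<in> carrier ?T" "(a, m, \<zero>\<^bsub>B\<^esub>) \<in> carrier ?T" "(a', m', \<zero>\<^bsub>B\<^esub>) \<in> carrier ?T"
      "(a', \<zero>\<^bsub>M\<^esub>, \<zero>\<^bsub>B\<^esub>) \<in> carrier ?T" "(\<zero>\<^bsub>A\<^esub>, m', \<zero>\<^bsub>B\<^esub>) \<in> carrier ?T"
      "(\<zero>\<^bsub>A\<^esub>, \<zero>\<^bsub>M\<^esub>, b') \<in> carrier ?T"
      using c abm by (simp_all add: tri_algebra_simps)
    have "d (a, \<zero>\<^bsub>M\<^esub>, \<zero>\<^bsub>B\<^esub>) = (a', \<zero>\<^bsub>M\<^esub>, \<zero>\<^bsub>B\<^esub>)"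
      using s(4)[OF x e_closed(1)] c' x by (simp add: d_e1 dx e_mult abm c)
    moreover have "d (\<zero>\<^bsub>A\<^esub>, \<zero>\<^bsub>M\<^esub>, b) = (\<zero>\<^bsub>A\<^esub>, \<zero>\<^bsub>M\<^esub>, b')"
      using s(4)[OF e_closed(2) x] c' x by (simp add: d_e2 dx e_mult abm c)
    moreover have "d (a, m, \<zero>\<^bsub>B\<^esub>) = (a', m', \<zero>\<^bsub>B\<^esub>)"
      using s(4)[OF e_closed(1) x] c' x by (simp add: d_e1 dx e_mult abm c)
    then have "d (\<zero>\<^bsub>A\<^esub>, m, \<zero>\<^bsub>B\<^esub>) = (\<zero>\<^bsub>A\<^esub>, m', \<zero>\<^bsub>B\<^esub>)"
      using s(4)[OF c'(2) e_closed(2)] c' by (simp add: d_e2 e_mult abm c)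
    ultimately show "d (a, m, b) = (\<alpha> a, \<mu> m, \<beta> b)"
      "\<alpha> a \<in> carrier A" "\<mu> m \<in> carrier M" "\<beta> b \<in> carrier B"
      using abm c by (simp_all add: \<alpha>_def \<mu>_def \<beta>_def dx)
  qed
  have closed: "\<And>a. a \<in> carrier A \<Longrightarrow> \<alpha> a \<in> carrier A" "\<And>m. m \<in> carrier M \<Longrightarrow> \<mu> m \<in> carrier M"
    "\<And>b. b \<in> carrier B \<Longrightarrow> \<beta> b \<in> carrier B"
    using D(2-4)[of "\<zero>\<^bsub>A\<^esub>" "\<zero>\<^bsub>M\<^esub>" "\<zero>\<^bsub>B\<^esub>"] D(2)[of _ "\<zero>\<^bsub>M\<^esub>" "\<zero>\<^bsub>B\<^esub>"] D(3)[of "\<zero>\<^bsub>A\<^esub>" _ "\<zero>\<^bsub>B\<^esub>"]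
      D(4)[of "\<zero>\<^bsub>A\<^esub>" "\<zero>\<^bsub>M\<^esub>"] by auto
  have zero: "\<alpha> \<zero>\<^bsub>A\<^esub> = \<zero>\<^bsub>A\<^esub>" "\<mu> \<zero>\<^bsub>M\<^esub> = \<zero>\<^bsub>M\<^esub>" "\<beta> \<zero>\<^bsub>B\<^esub> = \<zero>\<^bsub>B\<^esub>"
    using s(5) D(1)[of "\<zero>\<^bsub>A\<^esub>" "\<zero>\<^bsub>M\<^esub>" "\<zero>\<^bsub>B\<^esub>"] by (simp_all add: tri_algebra_simps)
  have add: "\<alpha> (a \<oplus>\<^bsub>A\<^esub> a') = \<alpha> a \<oplus>\<^bsub>A\<^esub> \<alpha> a' \<and> \<mu> (m \<oplus>\<^bsub>M\<^esub> m') = \<mu> m \<oplus>\<^bsub>M\<^esub> \<mu> m'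
      \<and> \<beta> (b \<oplus>\<^bsub>B\<^esub> b') = \<beta> b \<oplus>\<^bsub>B\<^esub> \<beta> b'"
    if "a \<in> carrier A" "m \<in> carrier M" "b \<in> carrier B"
      "a' \<in> carrier A" "m' \<in> carrier M" "b' \<in> carrier B" for a m b a' m' b'
    using s(2)[of "(a, m, b)" "(a', m', b')"] that by (simp add: D(1) tri_algebra_simps)
  have smult: "\<alpha> (k \<odot>\<^bsub>A\<^esub> a) = k \<odot>\<^bsub>A\<^esub> \<alpha> a \<and> \<mu> (k \<odot>\<^bsub>M\<^esub> m) = k \<odot>\<^bsub>M\<^esub> \<mu> m
      \<and> \<beta> (k \<odot>\<^bsub>B\<^esub> b) = k \<odot>\<^bsub>B\<^esub> \<beta> b"
    if "a \<in> carrier A" "m \<in> carrier M" "b \<in> carrier B" "k \<in> carrier K" for a m b k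
    using s(3)[of k "(a, m, b)"] that by (simp add: D(1) tri_algebra_simps)
  have mult: "\<alpha> (a \<otimes>\<^bsub>A\<^esub> a') = \<alpha> a \<otimes>\<^bsub>A\<^esub> a' \<oplus>\<^bsub>A\<^esub> a \<otimes>\<^bsub>A\<^esub> \<alpha> a'
      \<and> \<mu> (lact M a m' \<oplus>\<^bsub>M\<^esub> ract M m b')
        = lact M (\<alpha> a) m' \<oplus>\<^bsub>M\<^esub> ract M (\<mu> m) b' \<oplus>\<^bsub>M\<^esub> (lact M a (\<mu> m') \<oplus>\<^bsub>M\<^esub> ract M m (\<beta> b'))
      \<and> \<beta> (b \<otimes>\<^bsub>B\<^esub> b') = \<beta> b \<otimes>\<^bsub>B\<^esub> b' \<oplus>\<^bsub>B\<^esub> b \<otimes>\<^bsub>B\<^esub> \<beta> b'"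
    if "a \<in> carrier A" "m \<in> carrier M" "b \<in> carrier B"
      "a' \<in> carrier A" "m' \<in> carrier M" "b' \<in> carrier B" for a m b a' m' b'
    using s(4)[of "(a, m, b)" "(a', m', b')"] that by (simp add: D(1) tri_algebra_simps act_simps)
  have "\<alpha> \<in> derivations K A"
    using add[of _ "\<zero>\<^bsub>M\<^esub>" "\<zero>\<^bsub>B\<^esub>" _ "\<zero>\<^bsub>M\<^esub>" "\<zero>\<^bsub>B\<^esub>"] smult[of _ "\<zero>\<^bsub>M\<^esub>" "\<zero>\<^bsub>B\<^esub>"]
      mult[of _ "\<zero>\<^bsub>M\<^esub>" "\<zero>\<^bsub>B\<^esub>" _ "\<zero>\<^bsub>M\<^esub>" "\<zero>\<^bsub>B\<^esub>"] closed
    by (simp add: derivations_def lin_End_def) (simp add: \<alpha>_def)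
  moreover have "\<beta> \<in> derivations K B"
    using add[of "\<zero>\<^bsub>A\<^esub>" "\<zero>\<^bsub>M\<^esub>" _ "\<zero>\<^bsub>A\<^esub>" "\<zero>\<^bsub>M\<^esub>"] smult[of "\<zero>\<^bsub>A\<^esub>" "\<zero>\<^bsub>M\<^esub>"]
      mult[of "\<zero>\<^bsub>A\<^esub>" "\<zero>\<^bsub>M\<^esub>" _ "\<zero>\<^bsub>A\<^esub>" "\<zero>\<^bsub>M\<^esub>"] closed
    by (simp add: derivations_def lin_End_def) (simp add: \<beta>_def)
  moreover have "\<mu> \<in> lin_End K M"
    using add[of "\<zero>\<^bsub>A\<^esub>" _ "\<zero>\<^bsub>B\<^esub>" "\<zero>\<^bsub>A\<^esub>" _ "\<zero>\<^bsub>B\<^esub>"] smult[of "\<zero>\<^bsub>A\<^esub>" _ "\<zero>\<^bsub>B\<^esub>"] closed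
    by (simp add: lin_End_def) (simp add: \<mu>_def)
  moreover have "\<mu> (lact M a m) = lact M (\<alpha> a) m \<oplus>\<^bsub>M\<^esub> lact M a (\<mu> m)"
    if "a \<in> carrier A" "m \<in> carrier M" for a m
    using mult[of a "\<zero>\<^bsub>M\<^esub>" "\<zero>\<^bsub>B\<^esub>" "\<zero>\<^bsub>A\<^esub>" m "\<zero>\<^bsub>B\<^esub>"] that closed by (simp add: act_simps zero)
  moreover have "\<mu> (ract M m b) = ract M (\<mu> m) b \<oplus>\<^bsub>M\<^esub> ract M m (\<beta> b)"
    if "m \<in> carrier M" "b \<in> carrier B" for m b
    using mult[of "\<zero>\<^bsub>A\<^esub>" m "\<zero>\<^bsub>B\<^esub>" "\<zero>\<^bsub>A\<^esub>" "\<zero>\<^bsub>M\<^esub>" b] that closed by (simp add: act_simps zero)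
  ultimately have data: "(\<alpha>, \<mu>, \<beta>) \<in> tri_data K A M B" by (simp add: tri_data_def)
  have "d = tri_der A M B \<alpha> \<mu> \<beta>"
    by (rule tri.derivation_eqI[OF d tri_der_derivation[OF data]])
      (auto simp: tri_algebra_simps(1) tri_der_apply D(1))
  with data show ?thesis by (rule that)
qed

text \<open>
  As \<open>d e\<^sub>1\<close> is concentrated in the corner, \<open>(d e\<^sub>1) e\<^sub>1 - e\<^sub>1 (d e\<^sub>1) = - d e\<^sub>1\<close>. Thus the inner derivation
  of \<open>d e\<^sub>1\<close> is the one to add; its explicit form is used in \<open>H1_diag_eq\<close>.
\<close>

lemma derivation_normal_form:
  assumes d: "d \<in> derivations K (tri_algebra A M B)"
  obtains \<alpha> \<mu> \<beta> where "(\<alpha>, \<mu>, \<beta>) \<in> tri_data K A M B"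
    "d \<oplus>\<^bsub>Der K (tri_algebra A M B)\<^esub> tri.ad (d e\<^sub>1) = tri_der A M B \<alpha> \<mu> \<beta>"
proof -
  let ?T = "tri_algebra A M B"
  obtain m where m: "m \<in> carrier M" "d e\<^sub>1 = (\<zero>\<^bsub>A\<^esub>, m, \<zero>\<^bsub>B\<^esub>)"
    using derivation_e1_entry[OF d] by blast
  have c: "d e\<^sub>1 \<in> carrier ?T" by (rule tri.derivation_simps(1)[OF d e_closed(1)])
  have "d e\<^sub>1 \<otimes>\<^bsub>?T\<^esub> e\<^sub>1 = \<zero>\<^bsub>?T\<^esub>" "e\<^sub>1 \<otimes>\<^bsub>?T\<^esub> d e\<^sub>1 = d e\<^sub>1"
    using m by (simp_all add: e_mult) (simp add: tri_algebra_simps)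
  then have "(d \<oplus>\<^bsub>Der K ?T\<^esub> tri.ad (d e\<^sub>1)) e\<^sub>1 = \<zero>\<^bsub>?T\<^esub>"
    using c e_closed(1) by (simp add: tri.Der_simps tri.ad_apply tri.M.minus_eq tri.M.r_neg)
  then show ?thesis
    using derivation_killing_e1[of "d \<oplus>\<^bsub>Der K ?T\<^esub> tri.ad (d e\<^sub>1)"] that
      tri.Der_closed(2)[OF d tri.ad_derivation[OF c]] by blast
qed

end


section \<open>The corner as a direct sum\<close>

lemma bimodule_bimod_sum:
  assumes "bimodule K A B M" "bimodule K A B N"
  shows "bimodule K A B (bimod_sum M N)"
proof -
  interpret M: bimodule K A B M by fact
  interpret N: bimodule K A B N by fact
  have ab: "abelian_group (bimod_sum M N)"
  proof (rule abelian_groupI)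
    fix x assume "x \<in> carrier (bimod_sum M N)"
    then obtain m n where x: "x = (m, n)" "m \<in> carrier M" "n \<in> carrier N"
      by (auto simp: bimod_sum_simps)
    then show "\<exists>y\<in>carrier (bimod_sum M N). y \<oplus>\<^bsub>bimod_sum M N\<^esub> x = \<zero>\<^bsub>bimod_sum M N\<^esub>"
      by (intro bexI[of _ "(\<ominus>\<^bsub>M\<^esub> m, \<ominus>\<^bsub>N\<^esub> n)"])
        (auto simp: bimod_sum_simps M.M.M.l_neg N.M.M.l_neg)
  qed (auto simp: bimod_sum_simps M.M.M.a_assoc N.M.M.a_assoc
      intro: M.M.M.a_comm N.M.M.a_comm)
  have "module K (bimod_sum M N)"
    by (rule moduleI[OF M.A.R.is_cring ab])
      (auto simp: bimod_sum_simps M.M.smult_l_distr N.M.smult_l_distr M.M.smult_r_distr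
        N.M.smult_r_distr M.M.smult_assoc1 N.M.smult_assoc1)
  moreover have "bimodule_axioms K A B (bimod_sum M N)"
    by unfold_locales
      (auto simp: bimod_sum_simps M.act_simps N.act_simps M.act_distribs N.act_distribs)
  ultimately show ?thesis
    by (intro bimodule.intro M.A.unital_algebra_axioms M.B.unital_algebra_axioms)
qed

locale bimodule_pair = M: bimodule K A B M + N: bimodule K A B N
  for K :: "'k ring" and A :: "('k, 'a) module" and B :: "('k, 'b) module"
    and M :: "('k, 'a, 'b, 'm) bimod" and N :: "('k, 'a, 'b, 'n) bimod"
begin

sublocale MN: bimodule K A B "bimod_sum M N"
  by (rule bimodule_bimod_sum[OF M.bimodule_axioms N.bimodule_axioms])

abbreviation "T \<equiv> tri_algebra A (bimod_sum M N) B"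

abbreviation "S \<equiv> tri_algebra A M B"

definition proj :: "'a \<times> ('m \<times> 'n) \<times> 'b \<Rightarrow> 'a \<times> 'm \<times> 'b"
  where "proj = (\<lambda>(a, (m, n), b). (a, m, b))"

definition incl :: "'a \<times> 'm \<times> 'b \<Rightarrow> 'a \<times> ('m \<times> 'n) \<times> 'b"
  where "incl = (\<lambda>(a, m, b). (a, (m, \<zero>\<^bsub>N\<^esub>), b))"

lemma proj_apply: "proj (a, (m, n), b) = (a, m, b)"
  by (simp add: proj_def)

lemma incl_apply: "incl (a, m, b) = (a, (m, \<zero>\<^bsub>N\<^esub>), b)"
  by (simp add: incl_def)

sublocale split_square_zero K T S proj incl
proof unfold_locales
  fix x y assume "x \<in> carrier T" "y \<in> carrier T" "proj x = \<zero>\<^bsub>S\<^esub>" "proj y = \<zero>\<^bsub>S\<^esub>"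
  then show "x \<otimes>\<^bsub>T\<^esub> y = \<zero>\<^bsub>T\<^esub>"
    by (auto simp: tri_algebra_simps bimod_sum_simps proj_apply M.act_simps N.act_simps)
qed (auto simp: tri_algebra_simps bimod_sum_simps proj_apply incl_apply N.act_simps)

lemma \<theta>_apply: "\<theta> (a, (m, n), b) = (a, (m, \<zero>\<^bsub>N\<^esub>), b)"
  by (simp add: \<theta>_def proj_apply incl_apply)

lemma restr_tri_der:
  "restr (tri_der A (bimod_sum M N) B \<alpha> \<gamma> \<beta>) = tri_der A M B \<alpha> (comp_MM M N \<gamma>) \<beta>"
proof
  fix x :: "'a \<times> 'm \<times> 'b"
  obtain a m b where x: "x = (a, m, b)" by (cases x)
  obtain m' n' where "\<gamma> (m, \<zero>\<^bsub>N\<^esub>) = (m', n')" by fastforce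
  then show "restr (tri_der A (bimod_sum M N) B \<alpha> \<gamma> \<beta>) x = tri_der A M B \<alpha> (comp_MM M N \<gamma>) \<beta> x"
    by (simp add: x restr_def tri_der_def incl_apply tri_algebra_simps bimod_sum_simps comp_MM_def
        proj_apply)
qed

lemma normal_representative:
  assumes d: "d \<in> derivations K T"
  obtains \<alpha> \<gamma> \<beta> where "(\<alpha>, \<gamma>, \<beta>) \<in> tri_data K A (bimod_sum M N) B"
    "cls (tri_der A (bimod_sum M N) B \<alpha> \<gamma> \<beta>) = cls d"
    "tri_der A (bimod_sum M N) B \<alpha> \<gamma> \<beta> = d \<oplus>\<^bsub>Der K T\<^esub> MN.tri.ad (d MN.e\<^sub>1)"
proof -
  obtain \<alpha> \<gamma> \<beta> where data: "(\<alpha>, \<gamma>, \<beta>) \<in> tri_data K A (bimod_sum M N) B"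
    and eq: "d \<oplus>\<^bsub>Der K T\<^esub> MN.tri.ad (d MN.e\<^sub>1) = tri_der A (bimod_sum M N) B \<alpha> \<gamma> \<beta>"
    using MN.derivation_normal_form[OF d] by blast
  have "d MN.e\<^sub>1 \<in> carrier T" by (rule MN.tri.derivation_simps(1)[OF d MN.e_closed(1)])
  then have "cls (tri_der A (bimod_sum M N) B \<alpha> \<gamma> \<beta>) = cls d"
    using MN.tri.HH1_class_add_ad[OF d] by (simp add: eq[symmetric])
  then show ?thesis using that[OF data _ eq[symmetric]] by blast
qed

text \<open>
  The union that defines \<open>r\<^sup>1\<^bsub>M,N\<^esub>\<close> is that of a single coset: a representative in normal form
  exists, and the restriction respects classes.
\<close>

lemma r1_class:
  assumes d: "d \<in> derivations K T"
  shows "r1 K A B M N (cls d) = HH1_class K S (restr d)"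
proof -
  have "HH1_class K S (tri_der A M B \<alpha> (comp_MM M N \<gamma>) \<beta>) = HH1_class K S (restr d)"
    if "(\<alpha>, \<gamma>, \<beta>) \<in> tri_data K A (bimod_sum M N) B" "tri_der A (bimod_sum M N) B \<alpha> \<gamma> \<beta> \<in> cls d"
    for \<alpha> \<gamma> \<beta>
    unfolding restr_tri_der[symmetric]
    using MN.tri.mem_HH1_classD[OF d that(2)] d by (intro restr_class_cong)
  moreover obtain \<alpha> \<gamma> \<beta> where "(\<alpha>, \<gamma>, \<beta>) \<in> tri_data K A (bimod_sum M N) B"
    "tri_der A (bimod_sum M N) B \<alpha> \<gamma> \<beta> \<in> cls d"
    using normal_representative[OF d] MN.tri.HH1_class_self MN.tri_der_derivation by metis
  ultimately have "{HH1_class K S (tri_der A M B \<alpha> (comp_MM M N \<gamma>) \<beta>) | \<alpha> \<gamma> \<beta>.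
      (\<alpha>, \<gamma>, \<beta>) \<in> tri_data K A (bimod_sum M N) B \<and> tri_der A (bimod_sum M N) B \<alpha> \<gamma> \<beta> \<in> cls d}
      = {HH1_class K S (restr d)}"
    by auto blast+
  then show ?thesis by (simp add: r1_def)
qed

sublocale induced_restriction K T S proj incl "r1 K A B M N"
  by unfold_locales (rule r1_class)

lemma tri_der_preserving_iff:
  assumes data: "(\<alpha>, \<gamma>, \<beta>) \<in> tri_data K A (bimod_sum M N) B"
  shows "tri_der A (bimod_sum M N) B \<alpha> \<gamma> \<beta> \<in> kernel_preserving
      \<longleftrightarrow> comp_NM M N \<gamma> = (\<lambda>n\<in>carrier N. \<zero>\<^bsub>M\<^esub>)" (is "?K \<longleftrightarrow> ?NM")
    and "tri_der A (bimod_sum M N) B \<alpha> \<gamma> \<beta> \<in> section_preserving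
      \<longleftrightarrow> comp_MN M N \<gamma> = (\<lambda>m\<in>carrier M. \<zero>\<^bsub>N\<^esub>)" (is "?S \<longleftrightarrow> ?MN")
proof -
  let ?d = "tri_der A (bimod_sum M N) B \<alpha> \<gamma> \<beta>"
  have d: "?d \<in> derivations K T" by (rule MN.tri_der_derivation[OF data])
  have app: "?d (a, (m, n), b) = (\<alpha> a, \<gamma> (m, n), \<beta> b)"
    if "a \<in> carrier A" "m \<in> carrier M" "n \<in> carrier N" "b \<in> carrier B" for a m n b
    using that by (simp add: MN.tri_der_apply bimod_sum_simps)
  have \<theta>: "\<theta> (a, mn, b) = (a, (fst mn, \<zero>\<^bsub>N\<^esub>), b)" for a mn b
    by (cases mn) (simp add: \<theta>_apply)
  have closed: "fst (\<gamma> (m, n)) \<in> carrier M" "snd (\<gamma> (m, n)) \<in> carrier N"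
    if "m \<in> carrier M" "n \<in> carrier N" for m n
    using MN.tri_dataD(3)[OF data, of "(m, n)"] that by (auto simp: bimod_sum_simps)
  have split: "fst (\<gamma> (m, n)) = fst (\<gamma> (m, \<zero>\<^bsub>N\<^esub>)) \<oplus>\<^bsub>M\<^esub> fst (\<gamma> (\<zero>\<^bsub>M\<^esub>, n))"
    if "m \<in> carrier M" "n \<in> carrier N" for m n
  proof -
    obtain p q p' q' where "\<gamma> (m, \<zero>\<^bsub>N\<^esub>) = (p, q)" "\<gamma> (\<zero>\<^bsub>M\<^esub>, n) = (p', q')" by fastforce
    then show ?thesis
      using MN.tri_dataD(4)[OF data, of "(m, \<zero>\<^bsub>N\<^esub>)" "(\<zero>\<^bsub>M\<^esub>, n)"] that
      by (simp add: bimod_sum_simps)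
  qed
  have "?K \<longleftrightarrow> (\<forall>m\<in>carrier M. \<forall>n\<in>carrier N. fst (\<gamma> (m, \<zero>\<^bsub>N\<^esub>)) = fst (\<gamma> (m, n)))"
    using M.A.M.zero_closed M.B.M.zero_closed
    by (auto simp: kernel_preserving_def d tri_algebra_simps bimod_sum_simps app \<theta>)
  also have "\<dots> \<longleftrightarrow> (\<forall>n\<in>carrier N. fst (\<gamma> (\<zero>\<^bsub>M\<^esub>, n)) = \<zero>\<^bsub>M\<^esub>)"
  proof -
    have "fst (\<gamma> (m, \<zero>\<^bsub>N\<^esub>)) = fst (\<gamma> (m, n)) \<longleftrightarrow> fst (\<gamma> (\<zero>\<^bsub>M\<^esub>, n)) = \<zero>\<^bsub>M\<^esub>"
      if "m \<in> carrier M" "n \<in> carrier N" for m n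
      using that closed by (subst split) (auto simp: M.M.M.add.r_cancel_one')
    then show ?thesis using M.M.M.zero_closed by auto
  qed
  also have "\<dots> \<longleftrightarrow> ?NM" by (auto simp: comp_NM_def fun_eq_iff restrict_def)
  finally show "?K \<longleftrightarrow> ?NM" .
  have "?S \<longleftrightarrow> (\<forall>m\<in>carrier M. snd (\<gamma> (m, \<zero>\<^bsub>N\<^esub>)) = \<zero>\<^bsub>N\<^esub>)"
    using M.A.M.zero_closed M.B.M.zero_closed N.M.M.zero_closed
    by (auto simp: section_preserving_def d tri_algebra_simps bimod_sum_simps app \<theta> prod_eq_iff)
  also have "\<dots> \<longleftrightarrow> ?MN" by (auto simp: comp_MN_def fun_eq_iff restrict_def)
  finally show "?S \<longleftrightarrow> ?MN" .
qed

text \<open>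
  The point is that passing to the normal form stays within the derivations that preserve both the
  kernel and the section: \<open>e\<^sub>1\<close> is in the section, hence so is \<open>d e\<^sub>1\<close>, and the inner derivation of an
  element of the section preserves the section.
\<close>

lemma H1_diag_eq: "H1_diag K A B M N = cls ` (kernel_preserving \<inter> section_preserving)"
proof
  show "H1_diag K A B M N \<subseteq> cls ` (kernel_preserving \<inter> section_preserving)"
    by (auto simp: H1_diag_def tri_der_preserving_iff)
  show "cls ` (kernel_preserving \<inter> section_preserving) \<subseteq> H1_diag K A B M N"
  proof clarify
    fix d assume dk: "d \<in> kernel_preserving" and ds: "d \<in> section_preserving"
    note d = kernel_preservingD(1)[OF dk]
    let ?t = "d MN.e\<^sub>1"
    have \<theta>e: "\<theta> MN.e\<^sub>1 = MN.e\<^sub>1" by (simp add: MN.e\<^sub>1_def bimod_sum_simps \<theta>_apply)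
    have t: "?t \<in> carrier T" "\<theta> ?t = ?t"
      using MN.tri.derivation_simps(1)[OF d MN.e_closed(1)]
        section_preservingD(2)[OF ds MN.e_closed(1)] by (simp_all add: \<theta>e)
    interpret D: lie_subalgebra "kernel_preserving \<inter> section_preserving" K "Der K T"
      by (rule lie_subalgebra_inter)
    have "d \<oplus>\<^bsub>Der K T\<^esub> MN.tri.ad ?t \<in> kernel_preserving \<inter> section_preserving"
      using MN.tri.Der.submoduleE(5)[OF D.submodule_axioms] dk ds ad_kernel_preserving[OF t(1)]
        ad_section_preserving[OF t] by blast
    then show "cls d \<in> H1_diag K A B M N"
      using normal_representative[OF d] tri_der_preserving_iff
      unfolding H1_diag_def by (smt (verit) IntD1 IntD2 mem_Collect_eq)
  qed
qed

end

theorem mainTheorem3: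
  fixes K :: "'k ring"
    and A :: "('k, 'a) module" and B :: "('k, 'b) module"
    and M :: "('k, 'a, 'b, 'm) bimod" and N :: "('k, 'a, 'b, 'n) bimod"
  assumes "cring K"
    and "unital_algebra K A" and "unital_algebra K B"
    and "bimodule K A B M" and "bimodule K A B N"
  defines "L \<equiv> HH1 K (tri_algebra A (bimod_sum M N) B)"
    and "L\<^sub>M \<equiv> HH1 K (tri_algebra A M B)"
    and "r \<equiv> r1 K A B M N"
    and "H\<^sub>0 \<equiv> H1_diag K A B M N"
  shows "\<exists>H\<^sub>1 H\<^sub>2.
    lie_subalgebra H\<^sub>1 K L \<and> lie_subalgebra H\<^sub>2 K L \<and>
    H\<^sub>1 <+>\<^bsub>L\<^esub> H\<^sub>2 = carrier L \<and> H\<^sub>1 \<inter> H\<^sub>2 = H\<^sub>0 \<and>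
    r \<in> lie_hom K (L\<lparr>carrier := H\<^sub>1\<rparr>) L\<^sub>M \<and>
    r \<in> lie_hom K (L\<lparr>carrier := H\<^sub>2\<rparr>) L\<^sub>M \<and>
    r \<in> lie_hom K (L\<lparr>carrier := H\<^sub>0\<rparr>) L\<^sub>M \<and>
    r ` H\<^sub>1 = r ` carrier L \<and> r ` H\<^sub>2 = r ` carrier L \<and> r ` H\<^sub>0 = r ` carrier L"
proof -
  interpret bimodule_pair K A B M N
    using assms(4,5) by (rule bimodule_pair.intro)
  show ?thesis
    unfolding L_def L\<^sub>M_def r_def H\<^sub>0_def H1_diag_eq
    using decomposition by (intro exI)
qed

end
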